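(* Let $k$ be a field, let $T$ be a tree, let $\phi$ be a function from the set of red-green components of $T$ to $\{\mathtt{generic},\mathtt{versal}\}$, let $M$ be a maximum matching of $T$, and fix invertible parameters in $k$ on the vertices not covered by $M$ of the generic components, satisfying the genericity condition. There is on $X^\phi_T$ a free action by a torus $\Lambda^\phi_T$ of dimension the rank $\operatorname{rk}(T,\phi)$.
   Context: A tree is a finite connected simply-connected graph. A vertex cover of a tree $T$ is a set of vertices meeting every edge; a minimum vertex cover is one of minimal cardinality. Canonical coloring: a vertex of $T$ is green if it lies in all minimum vertex covers, orange if it lies in some but not all minimum vertex covers, red if it lies in none. A matching of $T$ is a set of edges (called dominoes) such that every vertex lies in at most one of them; a maximum matching is one of maximal cardinality. Known fact: every maximum matching covers all orange and green vertices, so uncovered vertices are red. The red-green components of $T$ are the connected components of the graph whose vertices are the red and green vertices of $T$ and whose edges are the edges of $T$ with one red end and one green end. The dimension $\dim(C)$ of a red-green component $C$ is its number of red vertices minus its number of green vertices. The rank $\operatorname{rk}(T,\phi)$ is the sum of the dimensions of the red-green components $C$ with $\phi(C)=\mathtt{generic}$. Varieties: given $T$, $\phi$, a maximum matching $M$, and for every component $C$ with $\phi(C)=\mathtt{generic}$ and every vertex $u$ of $C$ not covered by $M$ a fixed value $\alpha_u\in k^\times$, $X^\phi_T$ is the affine scheme over $k$ with variables $x_i,x'_i$ for all vertices $i$ of $T$ and $\alpha_i$ for all vertices $i$ not covered by $M$ lying in components $C$ with $\phi(C)=\mathtt{versal}$, defined by the equations $x_ix'_i=1+\alpha_i\prod_{j}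 x_j$ for all vertices $i$ (product over the vertices $j$ adjacent to $i$) and the condition that all variables $\alpha_i$ are invertible; here $\alpha_i=1$ whenever $i$ is covered by $M$. Genericity condition (always assumed for every generic component $C$): a non-empty set $S$ of red vertices of $C$ is admissible if every green vertex of $C$ has either $0$ or $2$ neighbors in $S$. For every admissible set $S$ and every choice of signs $\varepsilon:S\to\{1,-1\}$ such that two distinct elements of $S$ sharing a common green neighbor have opposite signs, one requires $\prod_{i\in S}\alpha_i^{\varepsilon_i}\neq(-1)^{\#S}$. Torus: the group of all $(\lambda_i)_{i\in T}\in\mathbb{G}_m^T$ with $\prod_{j \text{ adjacent to } i}\lambda_j=1$ for all vertices $i$ acts on $X^\phi_T$ by $x_i\mapsto\lambda_ix_i$, $x'_i\mapsto\lambda_i^{-1}x'_i$, fixing the $\alpha_i$; its elements satisfy $\lambda_i=1$ for all green and orange $i$. $\Lambda^\phi_T$ is the subgroup of those $(\lambda_i)$ with $\lambda_i=1$ for every vertex $i$ not belonging to a generic red-green component, acting by restriction. *)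

theory Defs
  imports "HOL-Algebra.Algebra"
begin

section \<open>Trees, vertex covers, matchings\<close>

text \<open>A finite simple graph is given by its vertex set \<open>V\<close> and its set \<open>E\<close> of two-element edges.\<close>

definition graph_cycle :: "'v set set \<Rightarrow> 'v list \<Rightarrow> bool" where
  "graph_cycle E c \<longleftrightarrow>
     3 \<le> length c \<and> distinct c \<and> successively (\<lambda>u v. {u, v} \<in> E) c \<and> {last c, hd c} \<in> E"

definition is_tree :: "'v set \<Rightarrow> 'v set set \<Rightarrow> bool" where
  "is_tree V E \<longleftrightarrow>
     finite V \<and> V \<noteq> {} \<and> (\<forall>e\<in>E. e \<subseteq> V \<and> card e = 2) \<and>
     (\<forall>u\<in>V. \<forall>v\<in>V. (u, v) \<in> {(a, b). {a, b} \<in> E}\<^sup>*) \<and>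
     (\<nexists>c. graph_cycle E c)"

definition neighbors :: "'v set set \<Rightarrow> 'v \<Rightarrow> 'v set" where
  "neighbors E i = {j. {i, j} \<in> E}"

definition vertex_cover :: "'v set \<Rightarrow> 'v set set \<Rightarrow> 'v set \<Rightarrow> bool" where
  "vertex_cover V E W \<longleftrightarrow> W \<subseteq> V \<and> (\<forall>e\<in>E. e \<inter> W \<noteq> {})"

definition min_vertex_cover :: "'v set \<Rightarrow> 'v set set \<Rightarrow> 'v set \<Rightarrow> bool" where
  "min_vertex_cover V E W \<longleftrightarrow>
     vertex_cover V E W \<and> (\<forall>W'. vertex_cover V E W' \<longrightarrow> card W \<le> card W')"

definition green :: "'v set \<Rightarrow> 'v set set \<Rightarrow> 'v set" where
  "green V E = {v \<in> V. \<forall>W. min_vertex_cover V E W \<longrightarrow> v \<in> W}"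

definition red :: "'v set \<Rightarrow> 'v set set \<Rightarrow> 'v set" where
  "red V E = {v \<in> V. \<forall>W. min_vertex_cover V E W \<longrightarrow> v \<notin> W}"

definition matching :: "'v set set \<Rightarrow> 'v set set \<Rightarrow> bool" where
  "matching E M \<longleftrightarrow> M \<subseteq> E \<and> (\<forall>v. \<forall>e\<in>M. \<forall>e'\<in>M. v \<in> e \<and> v \<in> e' \<longrightarrow> e = e')"

definition maximum_matching :: "'v set set \<Rightarrow> 'v set set \<Rightarrow> bool" where
  "maximum_matching E M \<longleftrightarrow> matching E M \<and> (\<forall>M'. matching E M' \<longrightarrow> card M' \<le> card M)"

section \<open>Red-green components\<close>

definition rg_adjacent :: "'v set \<Rightarrow> 'v set set \<Rightarrow> ('v \<times> 'v) set" where
  "rg_adjacent V E =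
     {(u, v). {u, v} \<in> E \<and> (u \<in> red V E \<and> v \<in> green V E \<or> u \<in> green V E \<and> v \<in> red V E)}"

definition rg_components :: "'v set \<Rightarrow> 'v set set \<Rightarrow> 'v set set" where
  "rg_components V E = {(rg_adjacent V E)\<^sup>* `` {u} | u. u \<in> red V E \<union> green V E}"

definition dim_component :: "'v set \<Rightarrow> 'v set set \<Rightarrow> 'v set \<Rightarrow> int" where
  "dim_component V E C = int (card (C \<inter> red V E)) - int (card (C \<inter> green V E))"

datatype status = Generic | Versal

text \<open>Only the values of \<open>\<phi>\<close> on \<open>rg_components V E\<close> matter.\<close>

definition status_vertices ::
  "'v set \<Rightarrow> 'v set set \<Rightarrow> ('v set \<Rightarrow> status) \<Rightarrow> status \<Rightarrow> 'v set" where
  "status_vertices V E \<phi> s = \<Union>{C \<in> rg_components V E. \<phi> C = s}"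

definition rank :: "'v set \<Rightarrow> 'v set set \<Rightarrow> ('v set \<Rightarrow> status) \<Rightarrow> int" where
  "rank V E \<phi> = (\<Sum>C \<in> {C \<in> rg_components V E. \<phi> C = Generic}. dim_component V E C)"

section \<open>Genericity\<close>

definition admissible :: "'v set \<Rightarrow> 'v set set \<Rightarrow> 'v set \<Rightarrow> 'v set \<Rightarrow> bool" where
  "admissible V E C S \<longleftrightarrow>
     S \<noteq> {} \<and> S \<subseteq> C \<inter> red V E \<and>
     (\<forall>g \<in> C \<inter> green V E. card (neighbors E g \<inter> S) \<in> {0, 2})"

text \<open>The given values \<open>\<alpha>\<close> are only meaningful off \<open>\<Union>M\<close>; on covered vertices the parameter is 1.\<close>

definition parameter :: "('k, 'm) ring_scheme \<Rightarrow> 'v set set \<Rightarrow> ('v \<Rightarrow> 'k) \<Rightarrow> 'v \<Rightarrow> 'k" where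
  "parameter k M \<alpha> i = (if i \<in> \<Union>M then \<one>\<^bsub>k\<^esub> else \<alpha> i)"

definition generic_parameters ::
  "('k, 'm) ring_scheme \<Rightarrow> 'v set \<Rightarrow> 'v set set \<Rightarrow> 'v set set \<Rightarrow> ('v \<Rightarrow> 'k) \<Rightarrow> 'v set \<Rightarrow> bool" where
  "generic_parameters k V E M \<alpha> C \<longleftrightarrow>
     (\<forall>S (\<epsilon> :: 'v \<Rightarrow> int).
        admissible V E C S \<longrightarrow>
        \<epsilon> ` S \<subseteq> {1, -1} \<longrightarrow>
        (\<forall>i\<in>S. \<forall>j\<in>S. i \<noteq> j \<and> (\<exists>g \<in> green V E. i \<in> neighbors E g \<and> j \<in> neighbors E g)
            \<longrightarrow> \<epsilon> i = - \<epsilon> j) \<longrightarrow>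
        (\<Otimes>\<^bsub>k\<^esub>i\<in>S. parameter k M \<alpha> i [^]\<^bsub>k\<^esub> \<epsilon> i) \<noteq> (\<ominus>\<^bsub>k\<^esub> \<one>\<^bsub>k\<^esub>) [^]\<^bsub>k\<^esub> card S)"

section \<open>Functors on commutative algebras\<close>

text \<open>
  Affine schemes over \<open>k\<close> are represented by their functors of points, on the commutative
  \<open>k\<close>-algebras (\<^locale>\<open>algebra\<close>, possibly zero) whose carrier is a subset of a type \<open>'r\<close>. Results
  are stated for an arbitrary type \<open>'r\<close>; as soon as \<open>'r\<close> is large enough to carry all finitely
  generated \<open>k\<close>-algebras, Yoneda's lemma identifies natural maps between such functors with
  morphisms of schemes of finite type.
\<close>

definition alg_hom :: "('k, 'm) ring_scheme \<Rightarrow> ('k, 'r) module \<Rightarrow> ('k, 'r) module \<Rightarrow> ('r \<Rightarrow> 'r) set" where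
  "alg_hom k R S =
     {f \<in> ring_hom R S. \<forall>c\<in>carrier k. \<forall>a\<in>carrier R. f (c \<odot>\<^bsub>R\<^esub> a) = c \<odot>\<^bsub>S\<^esub> f a}"

definition map_family :: "'i set \<Rightarrow> ('r \<Rightarrow> 'r) \<Rightarrow> ('i \<Rightarrow> 'r) \<Rightarrow> 'i \<Rightarrow> 'r" where
  "map_family I f x = (\<lambda>i\<in>I. f (x i))"

definition Gm_power :: "'i set \<Rightarrow> ('k, 'r) module \<Rightarrow> ('i \<Rightarrow> 'r) monoid" where
  "Gm_power I R = product_group I (\<lambda>_. units_of R)"

text \<open>
  \<open>G\<close> is a group-valued functor, \<open>Gmap\<close> its action on algebra homomorphisms; the isomorphism
  \<open>\<theta>\<close> with the \<open>d\<close>-th power of the multiplicative group must be natural in the algebra.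
\<close>

definition is_torus ::
  "('k, 'm) ring_scheme \<Rightarrow> (('k, 'r) module \<Rightarrow> 'g monoid) \<Rightarrow> (('r \<Rightarrow> 'r) \<Rightarrow> 'g \<Rightarrow> 'g) \<Rightarrow> nat \<Rightarrow> bool" where
  "is_torus k G Gmap d \<longleftrightarrow>
     (\<exists>\<theta> :: ('k, 'r) module \<Rightarrow> (nat \<Rightarrow> 'r) \<Rightarrow> 'g.
        (\<forall>R. algebra k R \<longrightarrow> \<theta> R \<in> iso (Gm_power {..<d} R) (G R)) \<and>
        (\<forall>R S f. algebra k R \<longrightarrow> algebra k S \<longrightarrow> f \<in> alg_hom k R S \<longrightarrow>
           (\<forall>t \<in> carrier (Gm_power {..<d} R).
              \<theta> S (map_family {..<d} f t) = Gmap f (\<theta> R t))))"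

definition is_scheme_action ::
  "('k, 'm) ring_scheme \<Rightarrow> (('k, 'r) module \<Rightarrow> 'g monoid) \<Rightarrow> (('r \<Rightarrow> 'r) \<Rightarrow> 'g \<Rightarrow> 'g) \<Rightarrow>
   (('k, 'r) module \<Rightarrow> 'x set) \<Rightarrow> (('r \<Rightarrow> 'r) \<Rightarrow> 'x \<Rightarrow> 'x) \<Rightarrow>
   (('k, 'r) module \<Rightarrow> 'g \<Rightarrow> 'x \<Rightarrow> 'x) \<Rightarrow> bool" where
  "is_scheme_action k G Gmap Y Ymap act \<longleftrightarrow>
     (\<forall>R. algebra k R \<longrightarrow> group_action (G R) (Y R) (act R)) \<and>
     (\<forall>R S f. algebra k R \<longrightarrow> algebra k S \<longrightarrow> f \<in> alg_hom k R S \<longrightarrow>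
        (\<forall>g \<in> carrier (G R). \<forall>p \<in> Y R.
           Gmap f g \<in> carrier (G S) \<and> Ymap f p \<in> Y S \<and>
           Ymap f (act R g p) = act S (Gmap f g) (Ymap f p)))"

definition is_free_action ::
  "('k, 'm) ring_scheme \<Rightarrow> (('k, 'r) module \<Rightarrow> 'g monoid) \<Rightarrow>
   (('k, 'r) module \<Rightarrow> 'x set) \<Rightarrow> (('k, 'r) module \<Rightarrow> 'g \<Rightarrow> 'x \<Rightarrow> 'x) \<Rightarrow> bool" where
  "is_free_action k G Y act \<longleftrightarrow>
     (\<forall>R. algebra k R \<longrightarrow> (\<forall>p \<in> Y R. stabilizer (G R) (act R) p = {\<one>\<^bsub>G R\<^esub>}))"

section \<open>The variety of a tree\<close>

definition versal_uncovered ::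
  "'v set \<Rightarrow> 'v set set \<Rightarrow> ('v set \<Rightarrow> status) \<Rightarrow> 'v set set \<Rightarrow> 'v set" where
  "versal_uncovered V E \<phi> M = status_vertices V E \<phi> Versal - \<Union>M"

text \<open>
  Coefficient \<open>\<alpha>\<^sub>i\<close> in an algebra \<open>R\<close>: a variable \<open>a i\<close> if \<open>i\<close> is uncovered and versal, and
  otherwise the image of an element of \<open>k\<close> (the value 1 or the fixed parameter).
\<close>

definition coefficient ::
  "('k, 'm) ring_scheme \<Rightarrow> 'v set \<Rightarrow> 'v set set \<Rightarrow> ('v set \<Rightarrow> status) \<Rightarrow> 'v set set \<Rightarrow> ('v \<Rightarrow> 'k) \<Rightarrow>
   ('k, 'r) module \<Rightarrow> ('v \<Rightarrow> 'r) \<Rightarrow> 'v \<Rightarrow> 'r" where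
  "coefficient k V E \<phi> M \<alpha> R a i =
     (if i \<in> versal_uncovered V E \<phi> M then a i else parameter k M \<alpha> i \<odot>\<^bsub>R\<^esub> \<one>\<^bsub>R\<^esub>)"

text \<open>A point is a triple \<open>(x, x', a)\<close>.\<close>

definition tree_variety ::
  "('k, 'm) ring_scheme \<Rightarrow> 'v set \<Rightarrow> 'v set set \<Rightarrow> ('v set \<Rightarrow> status) \<Rightarrow> 'v set set \<Rightarrow> ('v \<Rightarrow> 'k) \<Rightarrow>
   ('k, 'r) module \<Rightarrow> (('v \<Rightarrow> 'r) \<times> ('v \<Rightarrow> 'r) \<times> ('v \<Rightarrow> 'r)) set" where
  "tree_variety k V E \<phi> M \<alpha> R =
     {(x, x', a).
        x \<in> V \<rightarrow>\<^sub>E carrier R \<and> x' \<in> V \<rightarrow>\<^sub>E carrier R \<and> a \<in> versal_uncovered V E \<phi> M \<rightarrow>\<^sub>E Units R \<and>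
        (\<forall>i\<in>V. x i \<otimes>\<^bsub>R\<^esub> x' i =
           \<one>\<^bsub>R\<^esub> \<oplus>\<^bsub>R\<^esub> coefficient k V E \<phi> M \<alpha> R a i \<otimes>\<^bsub>R\<^esub> (\<Otimes>\<^bsub>R\<^esub>j\<in>neighbors E i. x j))}"

definition tree_variety_map ::
  "'v set \<Rightarrow> 'v set set \<Rightarrow> ('v set \<Rightarrow> status) \<Rightarrow> 'v set set \<Rightarrow> ('r \<Rightarrow> 'r) \<Rightarrow>
   ('v \<Rightarrow> 'r) \<times> ('v \<Rightarrow> 'r) \<times> ('v \<Rightarrow> 'r) \<Rightarrow> ('v \<Rightarrow> 'r) \<times> ('v \<Rightarrow> 'r) \<times> ('v \<Rightarrow> 'r)" where
  "tree_variety_map V E \<phi> M f =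
     (\<lambda>(x, x', a). (map_family V f x, map_family V f x', map_family (versal_uncovered V E \<phi> M) f a))"

section \<open>The torus and its action\<close>

definition full_torus :: "'v set \<Rightarrow> 'v set set \<Rightarrow> ('k, 'r) module \<Rightarrow> ('v \<Rightarrow> 'r) monoid" where
  "full_torus V E R =
     (Gm_power V R)\<lparr>carrier := {l \<in> carrier (Gm_power V R).
        \<forall>i\<in>V. (\<Otimes>\<^bsub>R\<^esub>j\<in>neighbors E i. l j) = \<one>\<^bsub>R\<^esub>}\<rparr>"

definition generic_torus ::
  "'v set \<Rightarrow> 'v set set \<Rightarrow> ('v set \<Rightarrow> status) \<Rightarrow> ('k, 'r) module \<Rightarrow> ('v \<Rightarrow> 'r) monoid" where
  "generic_torus V E \<phi> R =
     (full_torus V E R)\<lparr>carrier := {l \<in> carrier (full_torus V E R).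
        \<forall>i \<in> V - status_vertices V E \<phi> Generic. l i = \<one>\<^bsub>R\<^esub>}\<rparr>"

definition torus_action ::
  "('k, 'm) ring_scheme \<Rightarrow> 'v set \<Rightarrow> 'v set set \<Rightarrow> ('v set \<Rightarrow> status) \<Rightarrow> 'v set set \<Rightarrow> ('v \<Rightarrow> 'k) \<Rightarrow>
   ('k, 'r) module \<Rightarrow> ('v \<Rightarrow> 'r) \<Rightarrow>
   ('v \<Rightarrow> 'r) \<times> ('v \<Rightarrow> 'r) \<times> ('v \<Rightarrow> 'r) \<Rightarrow> ('v \<Rightarrow> 'r) \<times> ('v \<Rightarrow> 'r) \<times> ('v \<Rightarrow> 'r)" where
  "torus_action k V E \<phi> M \<alpha> R l =
     (\<lambda>(x, x', a) \<in> tree_variety k V E \<phi> M \<alpha> R.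
        (\<lambda>i\<in>V. l i \<otimes>\<^bsub>R\<^esub> x i, \<lambda>i\<in>V. inv\<^bsub>R\<^esub> (l i) \<otimes>\<^bsub>R\<^esub> x' i, a))"

end

theory Submission
  imports Defs
begin

text \<open>
  By Koenig's theorem every green vertex is matched to a red one and every vertex outside \<open>\<Union>M\<close> is
  red, so the rank counts the uncovered vertices of the generic components. In a tree, stepping from
  a vertex to its partner and on to another neighbor of the partner is well-founded. Recursion along
  these steps shows that an element of the torus is 1 off the red vertices, and that its values at
  the uncovered generic vertices determine it and can be prescribed freely.

  For freeness, suppose that \<open>\<lambda>\<close> fixes a point and \<open>\<lambda>\<^sub>i \<noteq> 1\<close>. In the residue field of a maximal ideal
  containing the annihilator of \<open>\<lambda>\<^sub>i - 1\<close>, the coordinate \<open>x\<close> vanishes on the set \<open>Z\<close> of those \<open>j\<close> for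
  which the ideal contains the annihilator of \<open>\<lambda>\<^sub>j - 1\<close>, so that \<open>1 + \<alpha>\<^sub>j \<Prod> x\<^sub>g = 0\<close> there.
  No green vertex has exactly one neighbor in \<open>Z\<close>; hence a walk that leaves every green vertex
  through a chosen second neighbor in \<open>Z\<close> sweeps out an admissible set, with alternating signs, and
  the alternating product of the equations contradicts genericity.
\<close>

section \<open>Walks in forests\<close>

text \<open>Freeness is asked over every algebra, where a stabilizing \<lambda> may be 1 plus a
  nilpotent element. Such a \<lambda> becomes trivial in each residue field; what survives there is
  the vanishing of the coordinates it fixes. For this reason \<open>Z\<close> is cut out by
  annihilators: it collects the vertices where \<lambda> differs from 1 in a localization. Elements
  outside a prime ideal have their product outside it, and with the torus equation at a green vertex
  this rules out a single neighbor in \<open>Z\<close>. Genericity speaks of elements of k only. In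
  the alternating product each green vertex next to the admissible set occurs twice, with opposite
  signs, so its coordinate cancels; the remaining identity between parameters descends to k because
  k embeds in the residue field. On the combinatorial side acyclicity acts through one statement: a
  walk that never turns straight back never revisits a vertex. It yields uniqueness of paths, hence
  well-defined signs, and termination of the recursions.\<close>

definition forest :: "'v set set \<Rightarrow> bool" where
  "forest E \<longleftrightarrow> finite E \<and> (\<forall>e\<in>E. card e = 2) \<and> (\<nexists>c. graph_cycle E c)"

text \<open>A local substitute for simple paths: prolonging a walk at its head requires an edge and
  a comparison with the vertex two places on, while distinctness of all vertices comes for free in a
  forest.\<close>

fun nonbacktracking :: "'v set set \<Rightarrow> 'v list \<Rightarrow> bool" where
  "nonbacktracking E [] \<longleftrightarrow> True"
| "nonbacktracking E [a] \<longleftrightarrow> True"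
| "nonbacktracking E [a, b] \<longleftrightarrow> {a, b} \<in> E"
| "nonbacktracking E (a # b # c # p) \<longleftrightarrow> {a, b} \<in> E \<and> a \<noteq> c \<and> nonbacktracking E (b # c # p)"

lemma nonbacktracking_Cons:
  "nonbacktracking E (a # b # p) \<longleftrightarrow>
     {a, b} \<in> E \<and> (p = [] \<or> a \<noteq> hd p) \<and> nonbacktracking E (b # p)"
  by (cases p) auto

lemma nonbacktracking_tl: "nonbacktracking E (a # p) \<Longrightarrow> nonbacktracking E p"
  by (cases p) (auto simp: nonbacktracking_Cons)

lemma nonbacktracking_prefix: "nonbacktracking E (p @ q) \<Longrightarrow> nonbacktracking E p"
  by (induction E p rule: nonbacktracking.induct) (auto simp: nonbacktracking_Cons hd_append)

lemma successively_nonbacktracking: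
  "nonbacktracking E p \<Longrightarrow> successively (\<lambda>u v. {u, v} \<in> E) p"
  by (induction E p rule: nonbacktracking.induct) auto

text \<open>The induction for Koenig's theorem deletes edges. Forests survive this, whereas
  connectedness may be lost.\<close>

lemma forest_subset: "forest E \<Longrightarrow> E' \<subseteq> E \<Longrightarrow> forest E'"
proof -
  assume "forest E" "E' \<subseteq> E"
  moreover have "graph_cycle E c" if "graph_cycle E' c" for c
    using that \<open>E' \<subseteq> E\<close> unfolding graph_cycle_def
    by (auto intro: successively_mono)
  ultimately show "forest E'"
    unfolding forest_def by (meson finite_subset subsetD)
qed

lemma forest_edge_neq: "forest E \<Longrightarrow> {u, v} \<in> E \<Longrightarrow> u \<noteq> v"
  unfolding forest_def by force

lemma forest_edgeE:
  assumes "forest E" "e \<in> E" "v \<in> e"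
  obtains w where "e = {v, w}" "w \<noteq> v"
proof -
  have "card e = 2"
    using assms unfolding forest_def by blast
  then obtain x y where "e = {x, y}" "x \<noteq> y"
    by (meson card_2_iff)
  then show ?thesis
    using that assms(3) by blast
qed

text \<open>The tail is distinct by induction, so a repetition can only be a return to the head
  \<open>a\<close>. The stretch up to this return is a cycle: edges have two different ends and
  turning straight back is excluded, so it has at least three vertices.\<close>

lemma nonbacktracking_distinct:
  assumes "forest E" "nonbacktracking E p"
  shows "distinct p"
  using assms(2)
proof (induction p)
  case (Cons a q)
  then have q: "distinct q"
    using nonbacktracking_tl by metis
  show ?case
  proof (rule ccontr)
    assume "\<not> distinct (a # q)"
    then obtain ys zs where qs: "q = ys @ a # zs"
      using q by (metis distinct.simps(2) split_list)
    have nb: "nonbacktracking E ((a # ys) @ [a])"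
      using Cons.prems nonbacktracking_prefix[of E "(a # ys) @ [a]" zs] by (simp add: qs)
    obtain b ys' where ys: "ys = b # ys'"
      using nb forest_edge_neq[OF assms(1), of a a] by (cases ys) auto
    have "ys' \<noteq> []"
      using nb by (auto simp: ys)
    moreover have "successively (\<lambda>u v. {u, v} \<in> E) ((a # ys) @ [a])"
      using successively_nonbacktracking[OF nb] .
    ultimately have "graph_cycle E (a # ys)"
      using q unfolding graph_cycle_def successively_append_iff
      by (cases ys') (auto simp: ys qs)
    then show False
      using assms(1) unfolding forest_def by blast
  qed
qed simp

text \<open>Two walks that part at \<open>a\<close> form one nonbacktracking walk through
  \<open>a\<close>. The induction moves the vertices of \<open>p\<close> over to the other side
  until a single walk remains.\<close>

lemma nonbacktracking_join:
  assumes "forest E" "nonbacktracking E (a # p)" "nonbacktracking E (a # q)"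
    and "p = [] \<or> q = [] \<or> hd p \<noteq> hd q"
  shows "distinct (rev p @ a # q)"
  using assms(2-4)
proof (induction p arbitrary: a q)
  case Nil
  then show ?case using nonbacktracking_distinct[OF assms(1), of "a # q"] by simp
next
  case (Cons b p)
  have "nonbacktracking E (b # a # q)"
    using Cons.prems by (auto simp: nonbacktracking_Cons insert_commute)
  moreover have "p = [] \<or> hd p \<noteq> a" "nonbacktracking E (b # p)"
    using Cons.prems by (auto simp: nonbacktracking_Cons)
  ultimately have "distinct (rev p @ b # a # q)"
    using Cons.IH by fastforce
  then show ?case by simp
qed

text \<open>If the first steps differ, the two walks join to one in which the common end would occur
  twice; if they agree, the tails are compared.\<close>

lemma nonbacktracking_unique:
  assumes "forest E" "nonbacktracking E (a # p)" "nonbacktracking E (a # q)"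
    and "last (a # p) = last (a # q)"
  shows "p = q"
  using assms(2-4)
proof (induction p arbitrary: a q)
  case Nil
  then show ?case
    using nonbacktracking_distinct[OF assms(1), of "a # q"] by (auto split: if_splits)
next
  case (Cons b p)
  note nb = Cons.prems
  show ?case
  proof (cases q)
    case Nil
    then show ?thesis
      using nb nonbacktracking_distinct[OF assms(1), of "a # b # p"]
      by (metis distinct.simps(2) last_ConsL last_ConsR last_in_set list.distinct(1))
  next
    case (Cons c q')
    show ?thesis
    proof (cases "b = c")
      case True
      then show ?thesis
        using Cons.IH[of c q'] nb Cons nonbacktracking_tl[of E a] by simp
    next
      case False
      then have "distinct (rev (b # p) @ a # q)"
        using nonbacktracking_join[OF assms(1) nb(1,2)] Cons by simp
      moreover have "last (b # p) \<in> set (rev (b # p))" "last (b # p) \<in> set q"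
        using nb(3) Cons by (metis last_in_set list.distinct(1) set_rev, metis last_ConsR last_in_set list.distinct(1))
      ultimately show ?thesis
        by (metis disjoint_iff distinct_append list.set_intros(2))
    qed
  qed
qed

text \<open>Pairs are oriented edges. The later one stands first in the relation, so an infinite
  descending chain is an infinite nonbacktracking walk.\<close>

definition dart_step :: "'v set set \<Rightarrow> (('v \<times> 'v) \<times> 'v \<times> 'v) set" where
  "dart_step E = {((v, w), (u, v)) | u v w. {u, v} \<in> E \<and> {v, w} \<in> E \<and> w \<noteq> u}"

lemma wf_dart_step:
  assumes "forest E"
  shows "wf (dart_step E)"
  unfolding wf_iff_no_infinite_down_chain
proof
  assume "\<exists>f. \<forall>n. (f (Suc n), f n) \<in> dart_step E"
  then obtain f where f: "\<And>n. (f (Suc n), f n) \<in> dart_step E" by blast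
  define g where "g n = fst (f n)" for n
  have g: "{g n, g (Suc n)} \<in> E" "g (Suc (Suc n)) \<noteq> g n" for n
    using f[of n] f[of "Suc n"] unfolding dart_step_def g_def by auto
  \<comment> \<open>All segments are treated at once, since the induction on the length removes the
    first vertex and thereby shifts the start.\<close>
  have nb: "nonbacktracking E (map g [m..<m + n])" for m n
  proof (induction n arbitrary: m)
    case (Suc n)
    show ?case
    proof (cases n)
      case (Suc l)
      then have "map g [m..<m + Suc n] = g m # g (Suc m) # map g [Suc (Suc m)..<Suc (Suc m) + l]"
        by (simp add: upt_conv_Cons del: upt_Suc)
      moreover have "nonbacktracking E (g (Suc m) # map g [Suc (Suc m)..<Suc (Suc m) + l])"
        using Suc.IH[of "Suc m"] Suc by (simp add: upt_conv_Cons del: upt_Suc)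
      moreover have "map g [Suc (Suc m)..<Suc (Suc m) + l] = [] \<or>
          hd (map g [Suc (Suc m)..<Suc (Suc m) + l]) = g (Suc (Suc m))"
        by (cases l) (auto simp: upt_conv_Cons simp del: upt_Suc)
      ultimately show ?thesis
        using g[of m] by (simp only: nonbacktracking_Cons) metis
    qed simp
  qed simp
  have "inj g"
  proof (rule inj_onI)
    fix i j assume eq: "g i = g j"
    have "distinct (map g [0..<0 + (Suc (i + j))])"
      using nonbacktracking_distinct[OF assms nb] by blast
    then have "inj_on g {0..<Suc (i + j)}"
      by (simp add: distinct_map del: upt_Suc)
    with eq show "i = j"
      by (auto simp: inj_on_def)
  qed
  moreover have "range g \<subseteq> \<Union>E"
    using g(1) by blast
  moreover have "finite (\<Union>E)"
    using assms unfolding forest_def by (metis finite_Union card.infinite zero_neq_numeral)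
  ultimately show False
    by (meson finite_imageD finite_subset infinite_UNIV_nat)
qed

section \<open>Koenig's theorem for forests\<close>

text \<open>Besides the inequality the injection is handed out: when matching and cover have equal
  size it is onto, which locates every cover vertex on a domino.\<close>

lemma card_matching_le_cover:
  assumes "matching E M" "finite W" "\<forall>e\<in>E. e \<inter> W \<noteq> {}"
  obtains f where "inj_on f M" "\<And>e. e \<in> M \<Longrightarrow> f e \<in> e \<inter> W" "card M \<le> card W"
proof -
  define f where "f e = (SOME v. v \<in> e \<inter> W)" for e
  have "M \<subseteq> E"
    using assms(1) by (simp add: matching_def)
  then have f: "f e \<in> e \<inter> W" if "e \<in> M" for e
    using that assms(3) unfolding f_def by (metis some_in_eq subsetD)
  have "inj_on f M"
  proof (rule inj_onI)
    fix e e' assume "e \<in> M" "e' \<in> M" "f e = f e'"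
    then show "e = e'"
      using assms(1) f[of e] f[of e'] unfolding matching_def by (metis IntD1)
  qed
  moreover from this have "card M \<le> card W"
    using f assms(2) by (intro card_inj_on_le[of f M W]) auto
  ultimately show ?thesis
    using that[of f] f by metis
qed

text \<open>Leaf stripping. The neighbor \<open>u\<close> of a leaf \<open>v\<close> goes into the
  cover and the edge between them into the matching; deleting all edges at \<open>u\<close> leaves a
  smaller forest that avoids \<open>v\<close> as well.\<close>

lemma forest_koenig:
  assumes "forest E"
  shows "\<exists>M W. matching E M \<and> finite W \<and> W \<subseteq> \<Union>E \<and> (\<forall>e\<in>E. e \<inter> W \<noteq> {}) \<and> card W \<le> card M"
  using assms
proof (induction "card E" arbitrary: E rule: less_induct)
  case less
  have fin: "finite E"
    using less.prems unfolding forest_def by blast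
  show ?case
  proof (cases "E = {}")
    case True
    then show ?thesis
      by (intro exI[of _ "{}"]) (auto simp: matching_def)
  next
    case False
    define Q where "Q = {(u, v). {u, v} \<in> E}"
    obtain e a where "e \<in> E" "a \<in> e"
      using False less.prems unfolding forest_def by (metis card.empty equals0I zero_neq_numeral)
    then obtain b where "{a, b} \<in> E"
      using forest_edgeE[OF less.prems, of e a] by metis
    then have "(a, b) \<in> Q"
      by (simp add: Q_def)
    \<comment> \<open>A dart without successor points to a leaf: every edge at its end leads back to
      where it came from.\<close>
    with wf_dart_step[OF less.prems, unfolded wf_eq_minimal]
    have "\<exists>z\<in>Q. \<forall>y. (y, z) \<in> dart_step E \<longrightarrow> y \<notin> Q"
      by metis
    then obtain z where z: "z \<in> Q" "\<forall>y. (y, z) \<in> dart_step E \<longrightarrow> y \<notin> Q"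
      by metis
    obtain u v where uv: "z = (u, v)" by (cases z)
    have e1: "{u, v} \<in> E"
      using z(1) unfolding uv Q_def by simp
    have e2: "w = u" if "{v, w} \<in> E" for w
    proof (rule ccontr)
      assume "w \<noteq> u"
      with e1 that have "((v, w), z) \<in> dart_step E"
        unfolding uv dart_step_def by blast
      then show False
        using z(2) that unfolding Q_def by simp
    qed
    define E' where "E' = {e \<in> E. u \<notin> e}"
    have "{u, v} \<in> E - E'" "E' \<subseteq> E"
      using e1 unfolding E'_def by auto
    then have "E' \<subset> E"
      by auto
    then have "card E' < card E" "forest E'"
      using fin less.prems by (simp_all add: psubset_card_mono forest_subset[of E E'] psubset_imp_subset)
    from less.hyps[OF this] obtain M W where IH: "matching E' M" "finite W" "W \<subseteq> \<Union>E'"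
        "\<forall>e\<in>E'. e \<inter> W \<noteq> {}" "card W \<le> card M"
      by blast
    have v: "v \<notin> e" if e': "e \<in> E'" for e
    proof
      assume "v \<in> e"
      then obtain w where "e = {v, w}"
        using e' \<open>E' \<subseteq> E\<close> less.prems forest_edgeE[of E e v] by (metis subsetD)
      then have "w = u" "e \<in> E'"
        using e' e2[of w] \<open>E' \<subseteq> E\<close> by auto
      then show False
        using \<open>e = {v, w}\<close> unfolding E'_def by simp
    qed
    have ME: "M \<subseteq> E'"
      using IH(1) unfolding matching_def by blast
    have disj: "u \<notin> e" "v \<notin> e" if "e \<in> M" for e
      using that ME v unfolding E'_def by auto
    have "matching E (insert {u, v} M)"
      unfolding matching_def
    proof (intro conjI allI ballI impI)
      show "insert {u, v} M \<subseteq> E"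
        using e1 ME \<open>E' \<subseteq> E\<close> by simp
      fix x e1 e2 assume "e1 \<in> insert {u, v} M" "e2 \<in> insert {u, v} M" "x \<in> e1 \<and> x \<in> e2"
      then show "e1 = e2"
        using disj IH(1) unfolding matching_def by (elim insertE) auto
    qed
    moreover have "\<forall>e\<in>E. e \<inter> insert u W \<noteq> {}"
      using IH(4) unfolding E'_def by auto
    moreover have "card (insert u W) \<le> card (insert {u, v} M)"
    proof -
      have "{u, v} \<notin> M" "finite M"
        using disj(1)[of "{u, v}"] ME fin \<open>E' \<subseteq> E\<close> by (auto intro: finite_subset)
      then show ?thesis
        using IH(2,5) by (simp add: card_insert_if)
    qed
    moreover have "insert u W \<subseteq> \<Union>E"
      using IH(3) e1 \<open>E' \<subseteq> E\<close> by auto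
    moreover have "finite (insert u W)"
      using IH(2) by simp
    ultimately show ?thesis
      by metis
  qed
qed

section \<open>Colors and maximum matchings\<close>

lemma tree_forest:
  assumes "is_tree V E"
  shows "forest E"
proof -
  have "finite E"
    using assms unfolding is_tree_def by (meson Pow_iff finite_Pow_iff finite_subset subsetI)
  then show ?thesis
    using assms unfolding is_tree_def forest_def by metis
qed

locale matched_tree =
  fixes V :: "'v set" and E M :: "'v set set"
  assumes tree: "is_tree V E"
    and maximum: "maximum_matching E M"
begin

lemma forest_E: "forest E"
  using tree by (rule tree_forest)

lemma finite_V: "finite V"
  using tree by (simp add: is_tree_def)

lemma edge_subset: "e \<in> E \<Longrightarrow> e \<subseteq> V"
  using tree by (simp add: is_tree_def)

lemma edge_in_V: "{u, v} \<in> E \<Longrightarrow> u \<in> V" "{u, v} \<in> E \<Longrightarrow> v \<in> V"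
  using edge_subset[of "{u, v}"] by auto

lemma neighbors_subset: "neighbors E i \<subseteq> V"
  using edge_in_V by (auto simp: neighbors_def)

lemma finite_neighbors [simp]: "finite (neighbors E i)"
  using neighbors_subset finite_V finite_subset by metis

lemma neighbors_sym: "j \<in> neighbors E i \<longleftrightarrow> i \<in> neighbors E j"
  by (simp add: neighbors_def insert_commute)

lemma matching_M: "matching E M"
  using maximum by (simp add: maximum_matching_def)

lemma M_subset: "M \<subseteq> E"
  using matching_M by (simp add: matching_def)

lemma M_same: "e \<in> M \<Longrightarrow> e' \<in> M \<Longrightarrow> x \<in> e \<Longrightarrow> x \<in> e' \<Longrightarrow> e = e'"
  using matching_M by (simp add: matching_def)

lemma M_unique: "{v, u} \<in> M \<Longrightarrow> {v, w} \<in> M \<Longrightarrow> u = w"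
proof -
  assume M: "{v, u} \<in> M" "{v, w} \<in> M"
  then have "{v, u} = {v, w}"
    by (rule M_same[where x = v]) auto
  then show "u = w"
    by (auto simp: doubleton_eq_iff)
qed

text \<open>Existence keeps the colors apart: were there no minimum vertex cover, every vertex would
  be vacuously both green and red.\<close>

lemma min_vertex_cover_exists: "\<exists>W. min_vertex_cover V E W"
proof -
  have "vertex_cover V E V"
    unfolding vertex_cover_def
  proof (intro conjI ballI)
    fix e assume e: "e \<in> E"
    then have "e \<noteq> {}"
      using forest_E unfolding forest_def by fastforce
    then show "e \<inter> V \<noteq> {}"
      using edge_subset[OF e] by auto
  qed simp
  then show ?thesis
    using ex_has_least_nat[of "vertex_cover V E" V card] unfolding min_vertex_cover_def by metis
qed

text \<open>
  By Koenig's theorem a minimum vertex cover is only as large as \<open>M\<close>, so no edge of \<open>M\<close> can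
  contain two of its vertices.
\<close>

lemma min_vertex_cover_matching:
  assumes "min_vertex_cover V E W"
  shows "W \<subseteq> \<Union>M" and "{u, v} \<in> M \<Longrightarrow> u \<in> W \<longleftrightarrow> v \<notin> W"
proof -
  have W: "W \<subseteq> V" "\<forall>e\<in>E. e \<inter> W \<noteq> {}" "finite W"
    using assms finite_V finite_subset unfolding min_vertex_cover_def vertex_cover_def by auto
  obtain M0 W0 where M0: "matching E M0" "W0 \<subseteq> \<Union>E" "\<forall>e\<in>E. e \<inter> W0 \<noteq> {}" "card W0 \<le> card M0"
    using forest_koenig[OF forest_E] by metis
  have "vertex_cover V E W0"
    using M0(2,3) edge_subset unfolding vertex_cover_def by auto
  then have le: "card W \<le> card M"
    using assms M0(1,4) maximum unfolding min_vertex_cover_def maximum_matching_def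
    by (meson order_trans)
  obtain f where f: "inj_on f M" "\<And>e. e \<in> M \<Longrightarrow> f e \<in> e \<inter> W" "card M \<le> card W"
    using card_matching_le_cover[OF matching_M W(3,2)] by metis
  \<comment> \<open>Since \<open>le\<close> bounds the cover by the number of dominoes, the
    injection of dominoes into \<open>W\<close> is onto, and every vertex of \<open>W\<close> is the
    chosen vertex of a domino.\<close>
  have "f ` M = W"
  proof (rule card_subset_eq[OF W(3)])
    show "f ` M \<subseteq> W" using f(2) by auto
    show "card (f ` M) = card W" using card_image[OF f(1)] f(3) le by simp
  qed
  have W_ex: "\<exists>e\<in>M. f e = x" if "x \<in> W" for x
    using that \<open>f ` M = W\<close> by auto
  show "W \<subseteq> \<Union>M"
  proof
    fix x assume "x \<in> W"
    then obtain e where "e \<in> M" "f e = x"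
      using W_ex by metis
    then show "x \<in> \<Union>M"
      using f(2)[of e] by auto
  qed
  have unique: "x = f e" if x: "x \<in> W" "x \<in> e" "e \<in> M" for x e
  proof -
    obtain e' where e': "e' \<in> M" "f e' = x"
      using W_ex[OF x(1)] by metis
    then have "x \<in> e'" using f(2)[of e'] by auto
    then have "e' = e"
      using x e' M_same[of e' e x] by simp
    then show ?thesis using e' by simp
  qed
  assume uv: "{u, v} \<in> M"
  then have "u \<noteq> v"
    using M_subset forest_edge_neq[OF forest_E] by auto
  moreover have "f {u, v} \<in> {u, v}" "f {u, v} \<in> W"
    using f(2)[OF uv] by auto
  moreover have "u \<in> W \<Longrightarrow> u = f {u, v}" "v \<in> W \<Longrightarrow> v = f {u, v}"
    using unique[OF _ _ uv] by simp_all
  ultimately show "u \<in> W \<longleftrightarrow> v \<notin> W"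
    by auto
qed

section \<open>Colors of neighbors and of the two ends of a domino\<close>

lemma red_subset: "red V E \<subseteq> V"
  and green_subset: "green V E \<subseteq> V"
  by (auto simp: red_def green_def)

lemma red_not_green: "i \<in> red V E \<Longrightarrow> i \<notin> green V E"
  using min_vertex_cover_exists unfolding red_def green_def by auto

text \<open>A cover that omits \<open>i\<close> must contain the other end of every edge at
  \<open>i\<close>.\<close>

lemma red_neighbor_green: "i \<in> red V E \<Longrightarrow> j \<in> neighbors E i \<Longrightarrow> j \<in> green V E"
proof -
  assume i: "i \<in> red V E" and "j \<in> neighbors E i"
  then have e: "{i, j} \<in> E" by (simp add: neighbors_def)
  have "j \<in> W" if W: "min_vertex_cover V E W" for W
  proof -
    have "{i, j} \<inter> W \<noteq> {}"
      using W e unfolding min_vertex_cover_def vertex_cover_def by auto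
    then show ?thesis
      using i W unfolding red_def by auto
  qed
  then show "j \<in> green V E"
    using edge_in_V[OF e] unfolding green_def by auto
qed

lemma uncovered_red:
  assumes "i \<in> V" "i \<notin> \<Union>M"
  shows "i \<in> red V E"
proof -
  have "i \<notin> W" if "min_vertex_cover V E W" for W
    using min_vertex_cover_matching(1)[OF that] assms(2) by (rule contra_subsetD)
  then show ?thesis
    using assms(1) by (simp add: red_def)
qed

lemma mate_green_red: "i \<in> green V E \<Longrightarrow> {i, j} \<in> M \<Longrightarrow> j \<in> red V E"
proof -
  assume i: "i \<in> green V E" and M: "{i, j} \<in> M"
  have "j \<in> V"
    using M M_subset edge_in_V(2)[of i j] by auto
  then show "j \<in> red V E"
    using i min_vertex_cover_matching(2)[OF _ M] unfolding red_def green_def by auto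
qed

lemma mate_neighbor: "{i, j} \<in> M \<Longrightarrow> j \<in> neighbors E i"
  using M_subset by (auto simp: neighbors_def)

lemma covered_mate: "i \<in> \<Union>M \<Longrightarrow> \<exists>j. {i, j} \<in> M"
  using M_subset forest_edgeE[OF forest_E, of _ i] by (metis UnionE subsetD)

lemma mate_red_green: "i \<in> red V E \<Longrightarrow> {i, j} \<in> M \<Longrightarrow> j \<in> green V E"
  using red_neighbor_green mate_neighbor by metis

text \<open>A red neighbor of \<open>u\<close> would make \<open>u\<close> green, and then its mate
  \<open>i\<close> red. Hence a recursion along \<open>mate_step\<close> that starts at a vertex
  that is not red never meets a red one.\<close>

lemma mate_not_red_neighbors:
  assumes "i \<in> V" "i \<notin> red V E" "{i, u} \<in> M" "j \<in> neighbors E u"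
  shows "j \<notin> red V E"
proof
  assume "j \<in> red V E"
  then have "u \<in> green V E"
    using assms(4) red_neighbor_green neighbors_sym by metis
  then show False
    using assms(2,3) mate_green_red by (metis insert_commute)
qed

text \<open>The torus equation at the mate \<open>u\<close> of \<open>v\<close> expresses the value
  at \<open>v\<close> by the values at the other neighbors \<open>w\<close> of \<open>u\<close>.
  These are the predecessors of \<open>v\<close> in this relation.\<close>

definition mate_step :: "('v \<times> 'v) set" where
  "mate_step = {(w, v). \<exists>u. {v, u} \<in> M \<and> w \<in> neighbors E u \<and> w \<noteq> v}"

lemma wf_mate_step: "wf mate_step"
  unfolding wf_iff_no_infinite_down_chain
proof
  assume "\<exists>f. \<forall>n. (f (Suc n), f n) \<in> mate_step"
  then obtain f where "\<forall>n. (f (Suc n), f n) \<in> mate_step" by metis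
  then have "\<forall>n. \<exists>u. {f n, u} \<in> M \<and> f (Suc n) \<in> neighbors E u \<and> f (Suc n) \<noteq> f n"
    by (simp add: mate_step_def)
  then obtain u where u: "\<And>n. {f n, u n} \<in> M" "\<And>n. f (Suc n) \<in> neighbors E (u n)"
      "\<And>n. f (Suc n) \<noteq> f n"
    by metis
  define h where "h n = (f n, u n)" for n
  have "(h (Suc n), h n) \<in> (dart_step E)\<^sup>+" for n
  proof -
    have E: "{f n, u n} \<in> E" "{u n, f (Suc n)} \<in> E" "{f (Suc n), u (Suc n)} \<in> E"
      using u M_subset by (auto simp: neighbors_def)
    have "((u n, f (Suc n)), (f n, u n)) \<in> dart_step E"
      using E u(3)[of n] unfolding dart_step_def by simp
    \<comment> \<open>\<open>u n\<close> is matched with \<open>f n\<close>, so it cannot be the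
      mate of \<open>f (Suc n)\<close> too. The walk therefore does not turn back at
      \<open>f (Suc n)\<close>, and one mate step amounts to two dart steps.\<close>
    moreover have "u (Suc n) \<noteq> u n"
      using M_unique[of "u n" "f n" "f (Suc n)"] u(1)[of n] u(1)[of "Suc n"] u(3)[of n]
      by (auto simp: insert_commute)
    then have "((f (Suc n), u (Suc n)), (u n, f (Suc n))) \<in> dart_step E"
      using E unfolding dart_step_def by simp
    ultimately show ?thesis
      unfolding h_def by (meson trancl.simps)
  qed
  moreover have "\<not> (\<exists>h. \<forall>n. (h (Suc n), h n) \<in> (dart_step E)\<^sup>+)"
    using wf_trancl[OF wf_dart_step[OF forest_E]] unfolding wf_iff_no_infinite_down_chain .
  ultimately show False
    by metis
qed

section \<open>Red-green components\<close>

lemma rg_adjacent_sym: "sym (rg_adjacent V E)"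
  unfolding rg_adjacent_def sym_def by (auto simp: insert_commute)

lemma rg_component_eq: "C \<in> rg_components V E \<Longrightarrow> u \<in> C \<Longrightarrow> C = (rg_adjacent V E)\<^sup>* `` {u}"
proof -
  assume "C \<in> rg_components V E" "u \<in> C"
  then obtain v where v: "C = (rg_adjacent V E)\<^sup>* `` {v}" "(v, u) \<in> (rg_adjacent V E)\<^sup>*"
    unfolding rg_components_def by auto
  have "(u, v) \<in> (rg_adjacent V E)\<^sup>*"
    using v(2) rg_adjacent_sym by (meson sym_rtrancl symD)
  then show ?thesis
    using v by (auto intro: rtrancl_trans)
qed

lemma rg_components_disjoint:
  "C \<in> rg_components V E \<Longrightarrow> C' \<in> rg_components V E \<Longrightarrow> u \<in> C \<Longrightarrow> u \<in> C' \<Longrightarrow> C = C'"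
  using rg_component_eq by metis

lemma rg_component_closed:
  "C \<in> rg_components V E \<Longrightarrow> u \<in> C \<Longrightarrow> (u, v) \<in> rg_adjacent V E \<Longrightarrow> v \<in> C"
  using rg_component_eq by (metis Image_singleton_iff r_into_rtrancl)

lemma rg_component_subset: "C \<in> rg_components V E \<Longrightarrow> C \<subseteq> red V E \<union> green V E"
proof
  fix v assume "C \<in> rg_components V E" "v \<in> C"
  then obtain u where "u \<in> red V E \<union> green V E" "(u, v) \<in> (rg_adjacent V E)\<^sup>*"
    unfolding rg_components_def by auto
  from this(2,1) show "v \<in> red V E \<union> green V E"
    by (induction rule: rtrancl_induct) (auto simp: rg_adjacent_def)
qed

lemma finite_rg_components: "finite (rg_components V E)"
proof -
  have "rg_components V E \<subseteq> Pow V"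
    using rg_component_subset red_subset green_subset by blast
  then show ?thesis
    using finite_V by (meson finite_Pow_iff finite_subset)
qed

lemma red_green_adjacent:
  "i \<in> red V E \<Longrightarrow> j \<in> neighbors E i \<Longrightarrow> (i, j) \<in> rg_adjacent V E \<and> (j, i) \<in> rg_adjacent V E"
  using red_neighbor_green unfolding rg_adjacent_def neighbors_def by (auto simp: insert_commute)

text \<open>All neighbors of a red vertex are green, so each tree edge at a red vertex is an edge of
  the red-green graph.\<close>

lemma rg_component_neighbor:
  assumes "C \<in> rg_components V E" "i \<in> red V E" "j \<in> neighbors E i"
  shows "i \<in> C \<longleftrightarrow> j \<in> C"
  using rg_component_closed[OF assms(1)] red_green_adjacent[OF assms(2,3)] by metis

lemma status_vertices_neighbor:
  assumes "i \<in> red V E" "j \<in> neighbors E i"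
  shows "i \<in> status_vertices V E \<phi> s \<longleftrightarrow> j \<in> status_vertices V E \<phi> s"
  unfolding status_vertices_def using rg_component_neighbor[OF _ assms] by auto

lemma status_vertices_subset: "status_vertices V E \<phi> s \<subseteq> red V E \<union> green V E"
  unfolding status_vertices_def using rg_component_subset by auto

lemma generic_not_versal:
  assumes "i \<in> status_vertices V E \<phi> Generic"
  shows "i \<notin> status_vertices V E \<phi> Versal"
proof
  assume "i \<in> status_vertices V E \<phi> Versal"
  then obtain C where C: "C \<in> rg_components V E" "\<phi> C = Versal" "i \<in> C"
    by (auto simp: status_vertices_def)
  obtain C' where C': "C' \<in> rg_components V E" "\<phi> C' = Generic" "i \<in> C'"
    using assms by (auto simp: status_vertices_def)
  have "C = C'"
    using rg_components_disjoint C C' by simp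
  then show False
    using C(2) C'(2) by simp
qed

text \<open>A domino with a green end is an edge of the red-green graph, so mating stays inside
  \<open>C\<close>. It pairs the green vertices of \<open>C\<close> with the covered red
  ones.\<close>

lemma dim_component_uncovered:
  assumes C: "C \<in> rg_components V E"
  shows "dim_component V E C = int (card (C - \<Union>M))"
proof -
  have CV: "C \<subseteq> V" "finite C"
    using rg_component_subset[OF C] red_subset green_subset finite_V by (auto intro: finite_subset)
  define f where "f i = (THE j. {i, j} \<in> M)" for i
  have f: "f i = j" if "{i, j} \<in> M" for i j
    unfolding f_def using that M_unique by (metis the_equality)
  have "bij_betw f (C \<inter> green V E) (C \<inter> red V E \<inter> \<Union>M)"
  proof (rule bij_betw_byWitness[where f' = f])
    have green: "f i \<in> C \<inter> red V E \<inter> \<Union>M \<and> f (f i) = i" if "i \<in> C \<inter> green V E" for i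
    proof -
      have "i \<in> \<Union>M"
        using that uncovered_red[of i] red_not_green[of i] green_subset by auto
      then obtain j where j: "{i, j} \<in> M"
        using covered_mate by metis
      then have "{j, i} \<in> M" by (simp add: insert_commute)
      moreover have "j \<in> red V E"
        using mate_green_red j that by auto
      ultimately show ?thesis
        using f[OF j] f[of j i] rg_component_neighbor[OF C, of j i] mate_neighbor[of j i] that
        by blast
    qed
    have red: "f i \<in> C \<inter> green V E \<and> f (f i) = i" if i: "i \<in> C \<inter> red V E \<inter> \<Union>M" for i
    proof -
      obtain j where j: "{i, j} \<in> M"
        using covered_mate[of i] i by blast
      then have "{j, i} \<in> M" by (simp add: insert_commute)
      then show ?thesis
        using f[OF j] f[of j i] rg_component_neighbor[OF C, of i j] mate_neighbor[OF j] i
          mate_red_green[OF _ j] by simp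
    qed
    show "\<forall>i\<in>C \<inter> green V E. f (f i) = i" "f ` (C \<inter> green V E) \<subseteq> C \<inter> red V E \<inter> \<Union>M"
      using green by auto
    show "\<forall>i\<in>C \<inter> red V E \<inter> \<Union>M. f (f i) = i" "f ` (C \<inter> red V E \<inter> \<Union>M) \<subseteq> C \<inter> green V E"
      using red by auto
  qed
  then have "card (C \<inter> green V E) = card (C \<inter> red V E \<inter> \<Union>M)"
    by (rule bij_betw_same_card)
  moreover have "C - \<Union>M = C \<inter> red V E - \<Union>M"
  proof -
    have "C - \<Union>M \<subseteq> red V E"
      using uncovered_red CV(1) by (metis DiffD1 DiffD2 subsetD subsetI)
    then show ?thesis
      by auto
  qed
  moreover have "card (C \<inter> red V E) = card (C \<inter> red V E \<inter> \<Union>M) + card (C \<inter> red V E - \<Union>M)"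
    using card_Int_Diff[of "C \<inter> red V E" "\<Union>M"] CV by simp
  ultimately show ?thesis
    unfolding dim_component_def by simp
qed

lemma rank_eq_card_uncovered:
  "rank V E \<phi> = int (card (status_vertices V E \<phi> Generic - \<Union>M))"
proof -
  let ?Cs = "{C \<in> rg_components V E. \<phi> C = Generic}"
  have "red V E \<union> green V E \<subseteq> V"
    using red_subset green_subset by simp
  then have fin: "finite C" if "C \<in> rg_components V E" for C
    using rg_component_subset[OF that] finite_V by (metis finite_subset)
  have "status_vertices V E \<phi> Generic - \<Union>M = (\<Union>C\<in>?Cs. C - \<Union>M)"
    unfolding status_vertices_def
  proof (rule Set.set_eqI)
    show "x \<in> \<Union>?Cs - \<Union>M \<longleftrightarrow> x \<in> (\<Union>C\<in>?Cs. C - \<Union>M)" for x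
      by (cases "x \<in> \<Union>M") auto
  qed
  also have "card \<dots> = (\<Sum>C\<in>?Cs. card (C - \<Union>M))"
  proof (rule card_UN_disjoint)
    show "\<forall>C\<in>?Cs. \<forall>C'\<in>?Cs. C \<noteq> C' \<longrightarrow> (C - \<Union>M) \<inter> (C' - \<Union>M) = {}"
    proof (intro ballI impI)
      fix C C' assume "C \<in> ?Cs" "C' \<in> ?Cs" "C \<noteq> C'"
      then have "C \<inter> C' = {}"
        using rg_components_disjoint[of C C'] by auto
      then show "(C - \<Union>M) \<inter> (C' - \<Union>M) = {}"
        by auto
    qed
  qed (use fin finite_rg_components in auto)
  finally have "int (card (status_vertices V E \<phi> Generic - \<Union>M)) = (\<Sum>C\<in>?Cs. int (card (C - \<Union>M)))"
    by simp
  also have "\<dots> = rank V E \<phi>"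
    unfolding rank_def using dim_component_uncovered by (intro sum.cong) auto
  finally show ?thesis ..
qed

end

section \<open>Construction of admissible sets\<close>

text \<open>
  Walks grow at the head of the list, two edges at a time, so \<open>r\<close> stays the last element.
\<close>

inductive guided_walk :: "'v set set \<Rightarrow> ('v \<Rightarrow> 'v \<Rightarrow> 'v) \<Rightarrow> 'v \<Rightarrow> 'v list \<Rightarrow> bool" for E jump r where
  start: "guided_walk E jump r [r]"
| extend: "guided_walk E jump r (i # p) \<Longrightarrow> {i, g} \<in> E \<Longrightarrow> p = [] \<or> hd p \<noteq> g \<Longrightarrow>
    guided_walk E jump r (jump g i # g # i # p)"

lemma guided_walk_ConsConsD:
  assumes "guided_walk E jump r (j # h # w)"
  shows "\<exists>i p. w = i # p \<and> guided_walk E jump r (i # p) \<and> {i, h} \<in> E \<and> (p = [] \<or> hd p \<noteq> h) \<and> j = jump h i"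
  using assms by (cases rule: guided_walk.cases) auto

context matched_tree
begin

text \<open>Uniqueness of paths does the work. Walks that pass a green vertex \<open>h\<close> enter
  it from the same vertex \<open>i\<close>, the one on the path to \<open>r\<close>, and leave it by
  \<open>nxt h i\<close>; so these two are the only neighbors of \<open>h\<close> in
  \<open>S\<close>.\<close>

lemma admissible_exists:
  assumes C: "C \<in> rg_components V E" and Z: "Z \<subseteq> C \<inter> red V E" and r: "r \<in> Z"
    and jump: "\<And>g i. i \<in> Z \<Longrightarrow> g \<in> neighbors E i \<Longrightarrow> \<exists>j\<in>Z. j \<in> neighbors E g \<and> j \<noteq> i"
  obtains S and \<epsilon> :: "'v \<Rightarrow> int" where
    "admissible V E C S" "S \<subseteq> Z" "\<epsilon> ` S \<subseteq> {1, -1}"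
    "\<And>i j g. i \<in> S \<Longrightarrow> j \<in> S \<Longrightarrow> i \<noteq> j \<Longrightarrow> i \<in> neighbors E g \<Longrightarrow> j \<in> neighbors E g \<Longrightarrow> \<epsilon> i = - \<epsilon> j"
proof -
  \<comment> \<open>One exit is fixed for each green vertex and entry. This keeps a third neighbor
    of \<open>g\<close> out of \<open>S\<close>, however large \<open>Z\<close> is around
    \<open>g\<close>.\<close>
  define nxt where "nxt g i = (SOME j. j \<in> Z \<and> j \<in> neighbors E g \<and> j \<noteq> i)" for g i
  have nxt: "nxt g i \<in> Z" "{g, nxt g i} \<in> E" "nxt g i \<noteq> i"
    if "i \<in> Z" "g \<in> neighbors E i" for g i
  proof -
    have "\<exists>j. j \<in> Z \<and> j \<in> neighbors E g \<and> j \<noteq> i"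
      using jump[OF that] by metis
    from someI_ex[OF this] show "nxt g i \<in> Z" "{g, nxt g i} \<in> E" "nxt g i \<noteq> i"
      unfolding nxt_def[symmetric] by (simp_all add: neighbors_def)
  qed
  let ?W = "guided_walk E nxt r"
  have W: "nonbacktracking E p \<and> p \<noteq> [] \<and> last p = r \<and> hd p \<in> Z \<and> even (length (tl p))" if "?W p" for p
    using that
  proof induction
    case start
    then show ?case using r by simp
  next
    case (extend i p g)
    then have i: "i \<in> Z" "g \<in> neighbors E i"
      by (simp_all add: neighbors_def)
    have "nonbacktracking E (g # i # p)"
      using extend by (auto simp: nonbacktracking_Cons insert_commute)
    then show ?case
      using extend nxt[OF i] by (auto simp: nonbacktracking_Cons insert_commute)
  qed
  have unique: "p = q" if "?W (i # p)" "?W (i # q)" for i p q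
    using nonbacktracking_unique[OF forest_E, of i p q] W[OF that(1)] W[OF that(2)] by simp
  define S where "S = {i. \<exists>p. ?W (i # p)}"
  have S_Z: "i \<in> Z" if "i \<in> S" for i
    using that W unfolding S_def by fastforce
  \<comment> \<open>The length of \<open>p\<close> is the distance from \<open>i\<close> to
    \<open>r\<close>. It is even and grows by 2 with every jump, so divisibility by 4 records the
    parity of the number of jumps.\<close>
  define \<epsilon> :: "'v \<Rightarrow> int" where "\<epsilon> i = (if \<exists>p. ?W (i # p) \<and> 4 dvd length p then 1 else -1)" for i
  have \<epsilon>: "\<epsilon> i = (if 4 dvd length p then 1 else -1)" if "?W (i # p)" for i p
    using that unique unfolding \<epsilon>_def by auto
  have pair: "\<exists>i1 i2. i1 \<noteq> i2 \<and> neighbors E h \<inter> S = {i1, i2} \<and> \<epsilon> i1 = - \<epsilon> i2"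
    if j: "j \<in> S" "h \<in> neighbors E j" for j h
  proof -
    \<comment> \<open>The entry \<open>i\<close> to \<open>h\<close> is \<open>j\<close> itself
      unless the walk to \<open>j\<close> has just crossed \<open>h\<close>; in that case it is the
      vertex visited before \<open>h\<close>.\<close>
    have "\<exists>i P. ?W (i # P) \<and> {i, h} \<in> E \<and> (P = [] \<or> hd P \<noteq> h)"
    proof -
      obtain w where w: "?W (j # w)"
        using j S_def by auto
      show ?thesis
      proof (cases "w = [] \<or> hd w \<noteq> h")
        case True
        then show ?thesis
          using w j by (auto simp: neighbors_def)
      next
        case False
        then obtain w' where "w = h # w'" by (cases w) auto
        with w guided_walk_ConsConsD[of E nxt r j h w'] show ?thesis
          by metis
      qed
    qed
    then obtain i P where P: "?W (i # P)" "{i, h} \<in> E" "P = [] \<or> hd P \<noteq> h" by metis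
    then have i: "i \<in> Z" "h \<in> neighbors E i"
      using W[OF P(1)] by (simp_all add: neighbors_def)
    define i' where "i' = nxt h i"
    have i': "?W (i' # h # i # P)"
      unfolding i'_def using P by (rule guided_walk.extend)
    have nb: "nonbacktracking E (h # i # P)"
      using W[OF P(1)] P by (auto simp: nonbacktracking_Cons insert_commute)
    \<comment> \<open>If the walk to \<open>x\<close> has not just crossed \<open>h\<close>,
      prefixing \<open>h\<close> gives a path from \<open>h\<close> to \<open>r\<close>, which must
      continue with \<open>i\<close>. Otherwise the walk came to \<open>h\<close>, again from
      \<open>i\<close>, and left by the chosen exit.\<close>
    have "x = i \<or> x = i'" if x: "x \<in> neighbors E h" "?W (x # w)" for x w
    proof (cases "w = [] \<or> hd w \<noteq> h")
      case True
      then have "nonbacktracking E (h # x # w)"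
        using W[OF x(2)] x(1) by (auto simp: nonbacktracking_Cons neighbors_def)
      then have "x # w = i # P"
        using nonbacktracking_unique[OF forest_E _ nb, of "x # w"] W[OF x(2)] W[OF P(1)] by simp
      then show ?thesis by simp
    next
      case False
      then obtain w' where w': "w = h # w'" by (cases w) auto
      have "nonbacktracking E (h # w')"
        using W[OF x(2)] w' by (auto dest: nonbacktracking_tl)
      moreover have "w' \<noteq> []"
        using W[OF x(2)] w' by auto
      ultimately have "w' = i # P"
        using nonbacktracking_unique[OF forest_E _ nb, of w'] W[OF x(2)] W[OF P(1)] w' by simp
      then show ?thesis
        using guided_walk_ConsConsD[of E nxt r x h w'] x(2) w' unfolding i'_def by auto
    qed
    moreover have "i' \<in> neighbors E h" "i \<in> neighbors E h"
      using nxt(2)[OF i] i neighbors_sym unfolding i'_def by (simp add: neighbors_def, metis)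
    ultimately have "neighbors E h \<inter> S = {i, i'}"
      using P(1) i' unfolding S_def by auto
    moreover have "i \<noteq> i'"
      using nxt(3)[OF i] unfolding i'_def by simp
    moreover have "\<epsilon> i = - \<epsilon> i'"
    proof -
      have "even (length P)"
        using W[OF P(1)] by simp
      then have "4 dvd length P \<longleftrightarrow> \<not> 4 dvd length (h # i # P)"
        by simp presburger
      then show ?thesis
        using \<epsilon>[OF P(1)] \<epsilon>[OF i'] by simp
    qed
    ultimately show ?thesis by metis
  qed
  show ?thesis
  proof
    show "S \<subseteq> Z" using S_Z by auto
    show "\<epsilon> ` S \<subseteq> {1, -1}" unfolding \<epsilon>_def by auto
    show "admissible V E C S"
      unfolding admissible_def
    proof (intro conjI ballI)
      show "S \<noteq> {}"
        using guided_walk.start unfolding S_def by fastforce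
      show "S \<subseteq> C \<inter> red V E"
        using S_Z Z by auto
      fix g assume "g \<in> C \<inter> green V E"
      show "card (neighbors E g \<inter> S) \<in> {0, 2}"
      proof (cases "neighbors E g \<inter> S = {}")
        case False
        then obtain j where "j \<in> S" "g \<in> neighbors E j"
          using neighbors_sym by fastforce
        from pair[OF this] show ?thesis by auto
      qed simp
    qed
    fix i j g
    assume ij: "i \<in> S" "j \<in> S" "i \<noteq> j" "i \<in> neighbors E g" "j \<in> neighbors E g"
    then have "g \<in> neighbors E i"
      using neighbors_sym by metis
    from pair[OF ij(1) this] obtain i1 i2 where
      "neighbors E g \<inter> S = {i1, i2}" "\<epsilon> i1 = - \<epsilon> i2" by metis
    moreover have "i \<in> neighbors E g \<inter> S" "j \<in> neighbors E g \<inter> S"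
      using ij by auto
    ultimately show "\<epsilon> i = - \<epsilon> j"
      using ij(3) by auto
  qed
qed

end

section \<open>The torus\<close>

lemma (in comm_monoid) finprod_Units:
  "f \<in> A \<rightarrow> Units G \<Longrightarrow> finprod G f A \<in> Units G"
proof (induction A rule: infinite_finite_induct)
  case (insert a A)
  then have "f \<in> A \<rightarrow> carrier G" "f a \<in> carrier G" "f a \<in> Units G"
    by auto
  then show ?case
    using insert by (subst finprod_insert) auto
qed auto

lemma (in comm_monoid) finprod_remove:
  assumes "finite A" "a \<in> A" "f \<in> A \<rightarrow> carrier G"
  shows "finprod G f A = f a \<otimes> finprod G f (A - {a})"
proof -
  have "finprod G f A = finprod G f (insert a (A - {a}))"
    using assms(2) by (simp add: insert_absorb)
  also have "\<dots> = f a \<otimes> finprod G f (A - {a})"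
    using assms by (subst finprod_insert) auto
  finally show ?thesis .
qed

lemma ring_hom_Units:
  assumes "cring R" "cring S" "f \<in> ring_hom R S" "a \<in> Units R"
  shows "f a \<in> Units S" and "f (inv\<^bsub>R\<^esub> a) = inv\<^bsub>S\<^esub> (f a)"
proof -
  interpret R: cring R by fact
  interpret S: cring S by fact
  have a: "a \<in> carrier R" "inv\<^bsub>R\<^esub> a \<in> carrier R"
    using assms(4) by auto
  then have fa: "f a \<in> carrier S" "f (inv\<^bsub>R\<^esub> a) \<in> carrier S"
    using ring_hom_closed[OF assms(3)] by auto
  have eq: "f a \<otimes>\<^bsub>S\<^esub> f (inv\<^bsub>R\<^esub> a) = \<one>\<^bsub>S\<^esub>"
    using ring_hom_mult[OF assms(3) a] ring_hom_one[OF assms(3)] assms(4) by simp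
  then show "f a \<in> Units S"
    using fa S.m_comm[OF fa] unfolding Units_def by auto
  show "f (inv\<^bsub>R\<^esub> a) = inv\<^bsub>S\<^esub> (f a)"
    using S.comm_inv_char[OF fa eq] by simp
qed

lemma carrier_Gm_power: "carrier (Gm_power I R) = I \<rightarrow>\<^sub>E Units R"
  by (simp add: Gm_power_def units_of_carrier)

lemma mult_Gm_power: "l \<otimes>\<^bsub>Gm_power I R\<^esub> m = (\<lambda>i\<in>I. l i \<otimes>\<^bsub>R\<^esub> m i)"
  by (simp add: Gm_power_def units_of_mult)

lemma one_Gm_power: "\<one>\<^bsub>Gm_power I R\<^esub> = (\<lambda>i\<in>I. \<one>\<^bsub>R\<^esub>)"
  by (simp add: Gm_power_def units_of_one)

lemma group_Gm_power:
  assumes "cring R"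
  shows "group (Gm_power I R)"
proof -
  interpret R: cring R by fact
  show ?thesis
    unfolding Gm_power_def using R.units_group by simp
qed

lemma inv_Gm_power:
  assumes "cring R" "l \<in> I \<rightarrow>\<^sub>E Units R"
  shows "inv\<^bsub>Gm_power I R\<^esub> l = (\<lambda>i\<in>I. inv\<^bsub>R\<^esub> (l i))"
proof -
  interpret R: cring R by fact
  have "inv\<^bsub>Gm_power I R\<^esub> l = (\<lambda>i\<in>I. inv\<^bsub>units_of R\<^esub> (l i))"
    unfolding Gm_power_def using assms(2) R.units_group
    by (intro inv_product_group) (simp_all add: units_of_carrier)
  also have "\<dots> = (\<lambda>i\<in>I. inv\<^bsub>R\<^esub> (l i))"
    using assms(2) R.units_of_inv by (intro restrict_ext) auto
  finally show ?thesis .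
qed

lemma mult_generic_torus: "l \<otimes>\<^bsub>generic_torus V E \<phi> R\<^esub> m = (\<lambda>i\<in>V. l i \<otimes>\<^bsub>R\<^esub> m i)"
  by (simp add: generic_torus_def full_torus_def mult_Gm_power)

lemma one_generic_torus: "\<one>\<^bsub>generic_torus V E \<phi> R\<^esub> = (\<lambda>i\<in>V. \<one>\<^bsub>R\<^esub>)"
  by (simp add: generic_torus_def full_torus_def one_Gm_power)

lemma carrier_generic_torus:
  "l \<in> carrier (generic_torus V E \<phi> R) \<longleftrightarrow>
     l \<in> V \<rightarrow>\<^sub>E Units R \<and> (\<forall>i\<in>V. (\<Otimes>\<^bsub>R\<^esub>j\<in>neighbors E i. l j) = \<one>\<^bsub>R\<^esub>) \<and>
     (\<forall>i\<in>V - status_vertices V E \<phi> Generic. l i = \<one>\<^bsub>R\<^esub>)"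
  by (simp add: generic_torus_def full_torus_def carrier_Gm_power)

context matched_tree
begin

lemma generic_torus_neighbors:
  assumes "l \<in> V \<rightarrow> Units R"
  shows "l \<in> neighbors E i \<rightarrow> Units R" and "cring R \<Longrightarrow> l \<in> neighbors E i \<rightarrow> carrier R"
proof -
  show U: "l \<in> neighbors E i \<rightarrow> Units R"
    using assms neighbors_subset[of i] by auto
  assume "cring R"
  then interpret R: cring R .
  show "l \<in> neighbors E i \<rightarrow> carrier R"
    using U R.Units_closed by (simp add: Pi_iff)
qed

lemma restrict_generic_torus:
  assumes "cring R" "f \<in> V \<rightarrow> Units R"
    and "\<And>i. i \<in> V \<Longrightarrow> (\<Otimes>\<^bsub>R\<^esub>j\<in>neighbors E i. f j) = \<one>\<^bsub>R\<^esub>"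
    and "\<And>i. i \<in> V - status_vertices V E \<phi> Generic \<Longrightarrow> f i = \<one>\<^bsub>R\<^esub>"
  shows "restrict f V \<in> carrier (generic_torus V E \<phi> R)"
proof -
  interpret R: cring R by fact
  have "finprod R (restrict f V) (neighbors E i) = finprod R f (neighbors E i)" for i
    using generic_torus_neighbors(2)[OF assms(2,1)] neighbors_subset[of i]
    by (intro R.finprod_cong') auto
  then show ?thesis
    unfolding carrier_generic_torus using assms by simp
qed

lemma generic_torus_subgroup:
  assumes "cring R"
  shows "subgroup (carrier (generic_torus V E \<phi> R)) (Gm_power V R)"
proof -
  interpret R: cring R by fact
  interpret G: group "Gm_power V R" by (rule group_Gm_power) fact
  show ?thesis
  proof
    show "carrier (generic_torus V E \<phi> R) \<subseteq> carrier (Gm_power V R)"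
      by (auto simp: carrier_generic_torus carrier_Gm_power)
    show "\<one>\<^bsub>Gm_power V R\<^esub> \<in> carrier (generic_torus V E \<phi> R)"
      unfolding one_Gm_power by (rule restrict_generic_torus[OF assms]) auto
    fix l assume "l \<in> carrier (generic_torus V E \<phi> R)"
    note l = this[unfolded carrier_generic_torus]
    then have lU: "l \<in> V \<rightarrow> Units R" by auto
    note l_nb = generic_torus_neighbors(1)[OF lU] generic_torus_neighbors(2)[OF lU assms]
    show "inv\<^bsub>Gm_power V R\<^esub> l \<in> carrier (generic_torus V E \<phi> R)"
      unfolding inv_Gm_power[OF assms conjunct1[OF l]]
    proof (rule restrict_generic_torus[OF assms])
      fix i assume "i \<in> V"
      have inv: "(\<lambda>j. inv\<^bsub>R\<^esub> l j) \<in> neighbors E i \<rightarrow> carrier R"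
        using l_nb(1)[of i] by auto
      have "(\<Otimes>\<^bsub>R\<^esub>j\<in>neighbors E i. inv\<^bsub>R\<^esub> l j) =
          (\<Otimes>\<^bsub>R\<^esub>j\<in>neighbors E i. l j) \<otimes>\<^bsub>R\<^esub> (\<Otimes>\<^bsub>R\<^esub>j\<in>neighbors E i. inv\<^bsub>R\<^esub> l j)"
        using l \<open>i \<in> V\<close> R.finprod_closed[OF inv] by simp
      also have "\<dots> = (\<Otimes>\<^bsub>R\<^esub>j\<in>neighbors E i. l j \<otimes>\<^bsub>R\<^esub> inv\<^bsub>R\<^esub> l j)"
        using R.finprod_multf[OF l_nb(2) inv] by simp
      also have "\<dots> = \<one>\<^bsub>R\<^esub>"
        using l_nb(1)[of i] by (intro R.finprod_one_eqI) (simp add: Pi_iff)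
      finally show "(\<Otimes>\<^bsub>R\<^esub>j\<in>neighbors E i. inv\<^bsub>R\<^esub> l j) = \<one>\<^bsub>R\<^esub>" .
    qed (use l lU in auto)
    fix m assume "m \<in> carrier (generic_torus V E \<phi> R)"
    note m = this[unfolded carrier_generic_torus]
    then have mU: "m \<in> V \<rightarrow> Units R" by auto
    show "l \<otimes>\<^bsub>Gm_power V R\<^esub> m \<in> carrier (generic_torus V E \<phi> R)"
      unfolding mult_Gm_power
    proof (rule restrict_generic_torus[OF assms])
      fix i assume "i \<in> V"
      then show "(\<Otimes>\<^bsub>R\<^esub>j\<in>neighbors E i. l j \<otimes>\<^bsub>R\<^esub> m j) = \<one>\<^bsub>R\<^esub>"
        using R.finprod_multf[OF l_nb(2) generic_torus_neighbors(2)[OF mU assms], of i] l m by simp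
    qed (use l m lU mU in auto)
  qed
qed

lemma generic_torus_Gm_power:
  "generic_torus V E \<phi> R = (Gm_power V R)\<lparr>carrier := carrier (generic_torus V E \<phi> R)\<rparr>"
  by (simp add: generic_torus_def full_torus_def)

lemma group_generic_torus: "cring R \<Longrightarrow> group (generic_torus V E \<phi> R)"
  by (subst generic_torus_Gm_power)
    (rule group.subgroup_imp_group[OF group_Gm_power generic_torus_subgroup])

lemma map_generic_torus:
  assumes "cring R" "cring S" "f \<in> ring_hom R S" "l \<in> carrier (generic_torus V E \<phi> R)"
  shows "map_family V f l \<in> carrier (generic_torus V E \<phi> S)"
proof -
  interpret ring_hom_cring R S f
    using assms(1-3) by (simp add: ring_hom_cring_def ring_hom_cring_axioms_def)
  note l = assms(4)[unfolded carrier_generic_torus]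
  then have lU: "l \<in> V \<rightarrow> Units R" by auto
  show ?thesis
    unfolding map_family_def
  proof (rule restrict_generic_torus[OF assms(2)])
    show "(\<lambda>i. f (l i)) \<in> V \<rightarrow> Units S"
      using ring_hom_Units(1)[OF assms(1-3)] lU by auto
    fix i assume "i \<in> V"
    then show "(\<Otimes>\<^bsub>S\<^esub>j\<in>neighbors E i. f (l j)) = \<one>\<^bsub>S\<^esub>"
      using hom_finprod[OF generic_torus_neighbors(2)[OF lU assms(1)], of i] l by (simp add: comp_def)
  qed (use l in auto)
qed

text \<open>The equation at the mate \<open>u\<close> of a covered vertex \<open>v\<close> is a
  product of units, so agreement at the other neighbors of \<open>u\<close> forces agreement at
  \<open>v\<close>.\<close>

lemma generic_torus_eqI:
  assumes "cring R" "l \<in> carrier (generic_torus V E \<phi> R)" "m \<in> carrier (generic_torus V E \<phi> R)"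
    and eq: "\<And>i. i \<in> status_vertices V E \<phi> Generic - \<Union>M \<Longrightarrow> l i = m i"
  shows "l = m"
proof -
  interpret R: cring R by fact
  note lm = assms(2,3)[unfolded carrier_generic_torus]
  have "v \<in> V \<longrightarrow> l v = m v" for v
  proof (induction v rule: wf_induct_rule[OF wf_mate_step])
    case (1 v)
    show ?case
    proof (intro impI)
      assume v: "v \<in> V"
      show "l v = m v"
      proof (cases "v \<in> status_vertices V E \<phi> Generic \<and> v \<in> \<Union>M")
        case False
        then show ?thesis using v lm eq[of v] by (cases "v \<in> status_vertices V E \<phi> Generic") auto
      next
        case True
        then obtain u where u: "{v, u} \<in> M"
          using covered_mate[of v] by auto
        then have u': "v \<in> neighbors E u" "u \<in> V"
          using mate_neighbor[OF u] neighbors_subset neighbors_sym by auto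
        have carr: "l \<in> neighbors E u \<rightarrow> carrier R" "m \<in> neighbors E u \<rightarrow> carrier R"
          using generic_torus_neighbors(2)[OF _ assms(1)] lm by auto
        let ?P = "\<lambda>l. finprod R l (neighbors E u - {v})"
        have "?P l = ?P m"
        proof (rule R.finprod_cong')
          fix w assume w: "w \<in> neighbors E u - {v}"
          then have "(w, v) \<in> mate_step"
            using u by (auto simp: mate_step_def)
          then show "l w = m w"
            using 1 w neighbors_subset by auto
        qed (use carr in auto)
        moreover have "l v \<otimes>\<^bsub>R\<^esub> ?P l = \<one>\<^bsub>R\<^esub>" "m v \<otimes>\<^bsub>R\<^esub> ?P m = \<one>\<^bsub>R\<^esub>"
          using lm u' R.finprod_remove[OF _ u'(1) carr(1)] R.finprod_remove[OF _ u'(1) carr(2)]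
          by auto
        moreover have "?P l \<in> Units R" "l v \<in> carrier R" "m v \<in> carrier R"
          using lm v neighbors_subset[of u] by (auto intro!: R.finprod_Units)
        ultimately show ?thesis
          by (metis R.Units_closed R.Units_l_cancel R.m_comm)
      qed
    qed
  qed
  then show ?thesis
    using PiE_ext[OF conjunct1[OF lm(1)] conjunct1[OF lm(2)]] by simp
qed

text \<open>Vertices that are not red are covered, and the recursion from them stays off the red
  vertices. It meets no uncovered vertex, so no free value enters and each equation reduces to
  1.\<close>

lemma generic_torus_off_red:
  assumes "cring R" "l \<in> carrier (generic_torus V E \<phi> R)" "v \<in> V" "v \<notin> red V E"
  shows "l v = \<one>\<^bsub>R\<^esub>"
proof -
  interpret R: cring R by fact
  note l = assms(2)[unfolded carrier_generic_torus]
  have "v \<in> V \<longrightarrow> v \<notin> red V E \<longrightarrow> l v = \<one>\<^bsub>R\<^esub>" for v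
  proof (induction v rule: wf_induct_rule[OF wf_mate_step])
    case (1 v)
    show ?case
    proof (intro impI)
      assume v: "v \<in> V" "v \<notin> red V E"
      then obtain u where u: "{v, u} \<in> M"
        using uncovered_red covered_mate by metis
      then have u': "v \<in> neighbors E u" "u \<in> V"
        using mate_neighbor[OF u] neighbors_subset neighbors_sym by auto
      have carr: "l \<in> neighbors E u \<rightarrow> carrier R"
        using generic_torus_neighbors(2)[OF _ assms(1)] l by auto
      have "finprod R l (neighbors E u - {v}) = \<one>\<^bsub>R\<^esub>"
      proof (rule R.finprod_one_eqI)
        fix w assume w: "w \<in> neighbors E u - {v}"
        then have "(w, v) \<in> mate_step" "w \<notin> red V E"
          using u mate_not_red_neighbors[OF v u] by (auto simp: mate_step_def)
        then show "l w = \<one>\<^bsub>R\<^esub>"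
          using 1 w neighbors_subset by auto
      qed
      moreover have "l v \<in> carrier R"
        using l v by auto
      ultimately show "l v = \<one>\<^bsub>R\<^esub>"
        using R.finprod_remove[OF _ u'(1) carr] l u'(2) by simp
    qed
  qed
  then show ?thesis using assms(3,4) by simp
qed

text \<open>The prescribed values go to the uncovered vertices, and 1 off the generic red ones. A
  covered generic red vertex solves the equation at its green mate; each generic green vertex has
  just one mate, so each such equation is solved exactly once.\<close>

lemma generic_torus_extend:
  assumes "cring R" and t: "t \<in> status_vertices V E \<phi> Generic - \<Union>M \<rightarrow> Units R"
  shows "\<exists>l\<in>carrier (generic_torus V E \<phi> R). \<forall>i\<in>status_vertices V E \<phi> Generic - \<Union>M. l i = t i"
proof -
  interpret R: cring R by fact
  let ?U = "status_vertices V E \<phi> Generic - \<Union>M"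
  let ?A = "status_vertices V E \<phi> Generic \<inter> red V E"
  define mate where "mate v = (THE u. {v, u} \<in> M)" for v
  have mate: "mate v = u" if "{v, u} \<in> M" for v u
    unfolding mate_def using that M_unique by (metis the_equality)
  \<comment> \<open>\<open>g\<close> is the part of the solution already known. \<open>wfrec\<close>
    supplies it on the predecessors of \<open>v\<close> only; for covered \<open>v\<close> these are
    exactly the other neighbors of its mate.\<close>
  define F where "F g v =
    (if v \<in> ?U then t v else if v \<in> ?A then inv\<^bsub>R\<^esub> (finprod R g (neighbors E (mate v) - {v})) else \<one>\<^bsub>R\<^esub>)"
    for g v
  define L where "L = wfrec mate_step F"
  have L: "L v = F (cut L mate_step v) v" for v
    unfolding L_def by (rule wfrec[OF wf_mate_step])
  have L_U: "L v = t v" if "v \<in> ?U" for v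
    unfolding L[of v] F_def using that by (rule if_P)
  have L_1: "L v = \<one>\<^bsub>R\<^esub>" if "v \<notin> ?U" "v \<notin> ?A" for v
    unfolding L[of v] F_def if_not_P[OF that(1)] if_not_P[OF that(2)] ..
  have L_cut: "L v = inv\<^bsub>R\<^esub> (finprod R (cut L mate_step v) (neighbors E (mate v) - {v}))"
    if "v \<notin> ?U" "v \<in> ?A" for v
    unfolding L[of v] F_def if_not_P[OF that(1)] if_P[OF that(2)] ..
  \<comment> \<open>Invertibility comes before the equations, since the inverse taken in
    \<open>F\<close> is meaningful only for a unit.\<close>
  have units: "L v \<in> Units R" for v
  proof (induction v rule: wf_induct_rule[OF wf_mate_step])
    case (1 v)
    show ?case
    proof (cases "v \<in> ?A - ?U")
      case False
      then consider "v \<in> ?U" | "v \<notin> ?U" "v \<notin> ?A"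
        by (meson DiffI)
      then show ?thesis
      proof cases
        case 1
        show ?thesis
          unfolding L_U[OF 1] using t 1 by (rule funcset_mem)
      next
        case 2
        show ?thesis
          unfolding L_1[OF 2] by simp
      qed
    next
      case True
      then obtain u where "{v, u} \<in> M"
        using covered_mate[of v] by auto
      then have "cut L mate_step v \<in> neighbors E (mate v) - {v} \<rightarrow> Units R"
        using mate 1 by (auto simp: mate_step_def cut_def)
      then have "finprod R (cut L mate_step v) (neighbors E (mate v) - {v}) \<in> Units R"
        by (rule R.finprod_Units)
      then show ?thesis
        using True L_cut[of v] by simp
    qed
  qed
  then have carr: "L v \<in> carrier R" for v
    by auto
  have L_A: "L v = inv\<^bsub>R\<^esub> (finprod R L (neighbors E u - {v}))" if "{v, u} \<in> M" "v \<in> ?A" for u v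
  proof -
    have "v \<notin> ?U"
      using that(1) by auto
    then have "L v = inv\<^bsub>R\<^esub> (finprod R (cut L mate_step v) (neighbors E u - {v}))"
      using that(2) mate[OF that(1)] L_cut[of v] by simp
    also have "finprod R (cut L mate_step v) (neighbors E u - {v}) = finprod R L (neighbors E u - {v})"
      using carr that(1) by (intro R.finprod_cong') (auto simp: cut_def mate_step_def)
    finally show ?thesis .
  qed
  have U_A: "?U \<subseteq> ?A"
  proof
    fix i assume "i \<in> ?U"
    then show "i \<in> ?A"
      using uncovered_red[of i] status_vertices_subset[of \<phi> Generic] red_subset green_subset by auto
  qed
  have prod: "finprod R L (neighbors E i) = \<one>\<^bsub>R\<^esub>" if i: "i \<in> V" for i
  proof (cases "i \<in> green V E \<inter> status_vertices V E \<phi> Generic")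
    case True
    have "i \<in> \<Union>M"
      using uncovered_red[OF i] red_not_green[of i] True by auto
    then obtain r where r: "{i, r} \<in> M"
      using covered_mate by metis
    then have r': "{r, i} \<in> M"
      by (simp add: insert_commute)
    have "r \<in> red V E" "r \<in> neighbors E i" "i \<in> neighbors E r"
      using mate_green_red[OF _ r] mate_neighbor[OF r] mate_neighbor[OF r'] True by auto
    then have "r \<in> ?A" "r \<in> neighbors E i"
      using status_vertices_neighbor[of r i \<phi> Generic] True by auto
    then show ?thesis
      using R.finprod_remove[of "neighbors E i" r L] L_A[OF r'] carr
        R.finprod_Units[of L "neighbors E i - {r}"] units by (simp add: Pi_def)
  next
    case False
    \<comment> \<open>Here all factors are 1: a generic red neighbor would make \<open>i\<close>
      itself green and generic.\<close>
    have "L j = \<one>\<^bsub>R\<^esub>" if j: "j \<in> neighbors E i" for j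
    proof -
      have "j \<notin> ?A"
        using False red_neighbor_green[of j i] status_vertices_neighbor[of j i \<phi> Generic] j neighbors_sym by auto
      then show ?thesis
        using L_1[OF contra_subsetD[OF U_A]] by simp
    qed
    then show ?thesis
      by (rule R.finprod_one_eqI)
  qed
  have "restrict L V \<in> carrier (generic_torus V E \<phi> R)"
    using prod units L_1 by (intro restrict_generic_torus[OF assms(1)]) auto
  moreover have "?U \<subseteq> V"
    using status_vertices_subset[of \<phi> Generic] red_subset green_subset by auto
  then have "\<forall>i\<in>?U. restrict L V i = t i"
    using L_U by auto
  ultimately show ?thesis
    by metis
qed

end

section \<open>Algebraic preliminaries for freeness\<close>

lemma (in cring) maximal_ideal_above:
  assumes I: "ideal I R" "\<one> \<notin> I"
  obtains m where "maximalideal m R" "I \<subseteq> m"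
proof -
  define A where "A = {J. ideal J R \<and> I \<subseteq> J \<and> \<one> \<notin> J}"
  have "\<exists>m\<in>A. \<forall>J\<in>A. m \<subseteq> J \<longrightarrow> J = m"
  proof (rule subset_Zorn_nonempty)
    show "A \<noteq> {}"
      using I unfolding A_def by auto
    fix C assume C: "C \<noteq> {}" "subset.chain A C"
    then have sub: "C \<subseteq> A"
      by (simp add: subset.chain_def)
    then have "subset.chain {J. ideal J R} C"
      using C(2) unfolding subset.chain_def A_def by auto
    then have "ideal (\<Union>C) R"
      using chain_Union_is_ideal[of C] C(1) by simp
    then show "\<Union>C \<in> A"
      using sub C(1) unfolding A_def by auto
  qed
  then obtain m where m: "m \<in> A" "\<And>J. J \<in> A \<Longrightarrow> m \<subseteq> J \<Longrightarrow> J = m"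
    by auto
  have "maximalideal m R"
  proof (rule maximalidealI)
    show "ideal m R" "carrier R \<noteq> m"
      using m(1) unfolding A_def by auto
    fix J assume J: "ideal J R" "m \<subseteq> J" "J \<subseteq> carrier R"
    show "J = m \<or> J = carrier R"
    proof (cases "\<one> \<in> J")
      case True
      then show ?thesis
        using ideal.one_imp_carrier[OF J(1)] by simp
    next
      case False
      then have "J \<in> A"
        using J m(1) unfolding A_def by auto
      then show ?thesis
        using m(2) J(2) by simp
    qed
  qed
  moreover have "I \<subseteq> m"
    using m(1) unfolding A_def by simp
  ultimately show ?thesis
    by (rule that)
qed

text \<open>The field consists of cosets and so lies on another type than \<open>R\<close>. The
  functors of points are not evaluated on it; only ring identities are carried over by
  \<open>h\<close>.\<close>

lemma (in cring) residue_field_hom: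
  assumes "ideal I R" "\<one> \<notin> I"
  obtains Q :: "'a set ring" and h where "field Q" "h \<in> ring_hom R Q" "\<And>s. s \<in> I \<Longrightarrow> h s = \<zero>\<^bsub>Q\<^esub>"
proof -
  obtain m where m: "maximalideal m R" "I \<subseteq> m"
    using maximal_ideal_above[OF assms] .
  interpret m: maximalideal m R by fact
  show ?thesis
  proof
    show "field (R Quot m)"
      by (rule m.quotient_is_field) (rule is_cring)
    show "(+>) m \<in> ring_hom R (R Quot m)"
      by (rule m.rcos_ring_hom)
    show "m +> s = \<zero>\<^bsub>R Quot m\<^esub>" if "s \<in> I" for s
      using m.a_rcos_const[of s] m(2) that by (auto simp: FactRing_def)
  qed
qed

text \<open>This is the annihilator of \<open>a\<close> minus 1, written without a difference so
  that an element fixed under multiplication by \<open>a\<close> belongs to it by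
  definition.\<close>

lemma (in cring) fixing_ideal:
  assumes "a \<in> carrier R"
  shows "ideal {s \<in> carrier R. s \<otimes> a = s} R"
proof (rule idealI)
  show "ring R" by (rule ring_axioms)
  show "subgroup {s \<in> carrier R. s \<otimes> a = s} (add_monoid R)"
    using assms by (intro add.subgroupI) (auto simp: l_minus l_distr a_inv_def[symmetric] intro: exI[of _ \<zero>])
  fix s x assume s: "s \<in> {s \<in> carrier R. s \<otimes> a = s}" "x \<in> carrier R"
  then show "x \<otimes> s \<in> {s \<in> carrier R. s \<otimes> a = s}"
    using assms by (auto simp: m_assoc)
  then show "s \<otimes> x \<in> {s \<in> carrier R. s \<otimes> a = s}"
    using s m_comm by auto
qed

lemma (in domain) finprod_nonzero:
  "f \<in> A \<rightarrow> carrier R - {\<zero>} \<Longrightarrow> finprod R f A \<noteq> \<zero>"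
proof (induction A rule: infinite_finite_induct)
  case (insert a A)
  then have "f \<in> A \<rightarrow> carrier R" "f a \<in> carrier R - {\<zero>}" "finprod R f A \<noteq> \<zero>"
    by auto
  then show ?case
    using insert.hyps integral by (subst finprod_insert) (auto, force)
qed auto

lemma (in comm_monoid) finprod_inv:
  assumes "f \<in> A \<rightarrow> Units G"
  shows "(\<Otimes>i\<in>A. inv (f i)) = inv (finprod G f A)"
proof -
  have c: "f \<in> A \<rightarrow> carrier G" "(\<lambda>i. inv (f i)) \<in> A \<rightarrow> carrier G"
    using assms Units_closed Units_inv_closed by (simp_all add: Pi_iff)
  have "finprod G f A \<otimes> (\<Otimes>i\<in>A. inv (f i)) = (\<Otimes>i\<in>A. f i \<otimes> inv (f i))"
    using finprod_multf[OF c] by simp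
  also have "\<dots> = \<one>"
    using assms by (intro finprod_one_eqI) (simp add: Pi_iff)
  finally show ?thesis
    using comm_inv_char finprod_closed[OF c(1)] finprod_closed[OF c(2)] by simp
qed

text \<open>For a field k and a field \<open>Q\<close> such a homomorphism is injective, which
  allows an identity between parameters to be carried back from \<open>Q\<close> to k.\<close>

lemma algebra_structure_hom:
  assumes "algebra k R" "h \<in> ring_hom R Q"
  shows "(\<lambda>c. h (c \<odot>\<^bsub>R\<^esub> \<one>\<^bsub>R\<^esub>)) \<in> ring_hom k Q"
proof -
  interpret algebra k R by fact
  show ?thesis
  proof (rule ring_hom_memI)
    fix c d assume cd: "c \<in> carrier k" "d \<in> carrier k"
    have "(c \<otimes>\<^bsub>k\<^esub> d) \<odot>\<^bsub>R\<^esub> \<one>\<^bsub>R\<^esub> = (c \<odot>\<^bsub>R\<^esub> \<one>\<^bsub>R\<^esub>) \<otimes>\<^bsub>R\<^esub> (d \<odot>\<^bsub>R\<^esub> \<one>\<^bsub>R\<^esub>)"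
      using cd smult_assoc1 smult_assoc2 by simp
    then show "h ((c \<otimes>\<^bsub>k\<^esub> d) \<odot>\<^bsub>R\<^esub> \<one>\<^bsub>R\<^esub>) = h (c \<odot>\<^bsub>R\<^esub> \<one>\<^bsub>R\<^esub>) \<otimes>\<^bsub>Q\<^esub> h (d \<odot>\<^bsub>R\<^esub> \<one>\<^bsub>R\<^esub>)"
      using ring_hom_mult[OF assms(2)] cd by simp
    show "h ((c \<oplus>\<^bsub>k\<^esub> d) \<odot>\<^bsub>R\<^esub> \<one>\<^bsub>R\<^esub>) = h (c \<odot>\<^bsub>R\<^esub> \<one>\<^bsub>R\<^esub>) \<oplus>\<^bsub>Q\<^esub> h (d \<odot>\<^bsub>R\<^esub> \<one>\<^bsub>R\<^esub>)"
      using ring_hom_add[OF assms(2)] cd smult_l_distr by simp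
  next
    show "h (c \<odot>\<^bsub>R\<^esub> \<one>\<^bsub>R\<^esub>) \<in> carrier Q" if "c \<in> carrier k" for c
      using ring_hom_closed[OF assms(2)] that by simp
    show "h (\<one>\<^bsub>k\<^esub> \<odot>\<^bsub>R\<^esub> \<one>\<^bsub>R\<^esub>) = \<one>\<^bsub>Q\<^esub>"
      using ring_hom_one[OF assms(2)] by simp
  qed
qed

text \<open>
  Every factor \<open>y\<close> occurs in one \<open>N i\<close> of either sign, so all of them cancel in the alternating
  product.
\<close>

lemma alternating_product:
  fixes \<epsilon> :: "'v \<Rightarrow> int"
  assumes k: "field k" and Q: "field Q" and \<iota>: "\<iota> \<in> ring_hom k Q"
    and S: "finite S" "\<epsilon> ` S \<subseteq> {1, -1}" and p: "p \<in> S \<rightarrow> Units k"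
    and N: "\<And>i. i \<in> S \<Longrightarrow> finite (N i)" and y: "\<And>i. i \<in> S \<Longrightarrow> y \<in> N i \<rightarrow> carrier Q"
    and rel: "\<And>i. i \<in> S \<Longrightarrow> \<iota> (p i) \<otimes>\<^bsub>Q\<^esub> finprod Q y (N i) = \<ominus>\<^bsub>Q\<^esub> \<one>\<^bsub>Q\<^esub>"
    and disj: "\<And>i j. i \<in> S \<Longrightarrow> j \<in> S \<Longrightarrow> i \<noteq> j \<Longrightarrow> \<epsilon> i = \<epsilon> j \<Longrightarrow> N i \<inter> N j = {}"
    and both: "\<And>i g. i \<in> S \<Longrightarrow> g \<in> N i \<Longrightarrow> \<exists>j\<in>S. \<epsilon> j = - \<epsilon> i \<and> g \<in> N j"
  shows "(\<Otimes>\<^bsub>k\<^esub>i\<in>S. p i [^]\<^bsub>k\<^esub> \<epsilon> i) = (\<ominus>\<^bsub>k\<^esub> \<one>\<^bsub>k\<^esub>) [^]\<^bsub>k\<^esub> card S"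
proof -
  interpret k: field k by fact
  interpret Q: field Q by fact
  interpret \<iota>: ring_hom_cring k Q \<iota>
    using \<iota> k.is_cring Q.is_cring by (simp add: ring_hom_cring_def ring_hom_cring_axioms_def)
  define A B where "A = {i \<in> S. \<epsilon> i = 1}" and "B = {i \<in> S. \<epsilon> i = -1}"
  have AB: "S = A \<union> B"
    using S(2) unfolding A_def B_def by auto
  have AB': "A \<inter> B = {}" "A \<subseteq> S" "B \<subseteq> S"
    unfolding A_def B_def by auto
  then have fin: "finite A" "finite B"
    using S(1) finite_subset by metis+
  have pc: "p \<in> T \<rightarrow> carrier k" "p \<in> T \<rightarrow> Units k" if "T \<subseteq> S" for T
    using p that by auto
  define Y where "Y = finprod Q y (\<Union>(N ` A))"
  \<comment> \<open>Each factor occurs with both signs, so the positive and the negative part of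
    \<open>S\<close> lead to the same product \<open>Y\<close>.\<close>
  have U: "\<Union>(N ` B) = \<Union>(N ` A)"
  proof
    show "\<Union>(N ` B) \<subseteq> \<Union>(N ` A)"
    proof
      fix g assume "g \<in> \<Union>(N ` B)"
      then obtain i where i: "i \<in> S" "\<epsilon> i = -1" "g \<in> N i"
        unfolding B_def by auto
      from both[OF i(1,3)] show "g \<in> \<Union>(N ` A)"
        unfolding A_def using i(2) by auto
    qed
    show "\<Union>(N ` A) \<subseteq> \<Union>(N ` B)"
    proof
      fix g assume "g \<in> \<Union>(N ` A)"
      then obtain i where i: "i \<in> S" "\<epsilon> i = 1" "g \<in> N i"
        unfolding A_def by auto
      from both[OF i(1,3)] show "g \<in> \<Union>(N ` B)"
        unfolding B_def using i(2) by auto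
    qed
  qed
  \<comment> \<open>Within one sign the sets \<open>N i\<close> are disjoint, so multiplying the
    relations over \<open>T\<close> produces each factor of \<open>Y\<close> just once.\<close>
  have Y: "\<iota> (finprod k p T) \<otimes>\<^bsub>Q\<^esub> Y = (\<ominus>\<^bsub>Q\<^esub> \<one>\<^bsub>Q\<^esub>) [^]\<^bsub>Q\<^esub> card T"
    if T: "T = A \<or> T = B" for T
  proof -
    have TS: "T \<subseteq> S" "finite T" "\<Union>(N ` T) = \<Union>(N ` A)"
      using T AB' fin U by metis+
    have "pairwise (\<lambda>i j. disjnt (N i) (N j)) T"
      unfolding pairwise_def disjnt_def
    proof (intro ballI impI)
      fix i j assume "i \<in> T" "j \<in> T" "i \<noteq> j"
      moreover from this have "\<epsilon> i = \<epsilon> j"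
        using T unfolding A_def B_def by auto
      ultimately show "N i \<inter> N j = {}"
        using disj TS(1) by (simp add: subset_iff)
    qed
    then have XT: "Y = (\<Otimes>\<^bsub>Q\<^esub>i\<in>T. finprod Q y (N i))"
      unfolding Y_def TS(3)[symmetric] using TS N y
      by (intro Q.finprod_UN_disjoint) (auto simp: Pi_iff subset_iff)
    have c: "(\<lambda>i. \<iota> (p i)) \<in> T \<rightarrow> carrier Q" "(\<lambda>i. finprod Q y (N i)) \<in> T \<rightarrow> carrier Q"
      using pc(1)[OF TS(1)] y TS(1) by auto
    have "\<iota> (finprod k p T) \<otimes>\<^bsub>Q\<^esub> Y = (\<Otimes>\<^bsub>Q\<^esub>i\<in>T. \<iota> (p i)) \<otimes>\<^bsub>Q\<^esub> (\<Otimes>\<^bsub>Q\<^esub>i\<in>T. finprod Q y (N i))"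
      using \<iota>.hom_finprod[OF pc(1)[OF TS(1)]] XT by (simp add: comp_def)
    also have "\<dots> = (\<Otimes>\<^bsub>Q\<^esub>i\<in>T. \<iota> (p i) \<otimes>\<^bsub>Q\<^esub> finprod Q y (N i))"
      using Q.finprod_multf[OF c] by simp
    also have "\<dots> = (\<Otimes>\<^bsub>Q\<^esub>i\<in>T. \<ominus>\<^bsub>Q\<^esub> \<one>\<^bsub>Q\<^esub>)"
      using rel TS(1) by (intro Q.finprod_cong') auto
    also have "\<dots> = (\<ominus>\<^bsub>Q\<^esub> \<one>\<^bsub>Q\<^esub>) [^]\<^bsub>Q\<^esub> card T"
      by (rule Q.finprod_const) simp
    finally show ?thesis .
  qed
  let ?e = "\<ominus>\<^bsub>k\<^esub> \<one>\<^bsub>k\<^esub>"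
  let ?a = "finprod k p A" and ?b = "finprod k p B"
  have Xc: "Y \<in> carrier Q"
    unfolding Y_def using y AB'(2) by (intro Q.finprod_closed) (auto simp: Pi_iff subset_iff)
  have ab: "?a \<in> carrier k" "?b \<in> carrier k" "?b \<in> Units k"
    using k.finprod_closed[OF pc(1)] k.finprod_Units[OF pc(2)] AB' by simp_all
  have e: "?e \<in> carrier k"
    by simp
  have pow: "\<iota> (?e [^]\<^bsub>k\<^esub> (n::nat)) = (\<ominus>\<^bsub>Q\<^esub> \<one>\<^bsub>Q\<^esub>) [^]\<^bsub>Q\<^esub> n" for n
    by (induction n) simp_all
  have \<iota>ab: "\<iota> ?a \<in> carrier Q" "\<iota> ?b \<in> carrier Q"
    using ab by auto
  \<comment> \<open>The product of the images of \<open>?a\<close> and \<open>?b\<close> with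
    \<open>Y\<close>, computed in two ways, eliminates \<open>Y\<close> without dividing by
    it.\<close>
  have "\<iota> (?a \<otimes>\<^bsub>k\<^esub> ?e [^]\<^bsub>k\<^esub> card B) = \<iota> ?a \<otimes>\<^bsub>Q\<^esub> (\<iota> ?b \<otimes>\<^bsub>Q\<^esub> Y)"
    using ab Y[of B] pow by simp
  also have "\<dots> = \<iota> ?b \<otimes>\<^bsub>Q\<^esub> (\<iota> ?a \<otimes>\<^bsub>Q\<^esub> Y)"
    using \<iota>ab Xc by (simp add: Q.m_lcomm)
  also have "\<dots> = \<iota> (?b \<otimes>\<^bsub>k\<^esub> ?e [^]\<^bsub>k\<^esub> card A)"
    using ab Y[of A] pow by simp
  finally have "\<iota> (?a \<otimes>\<^bsub>k\<^esub> ?e [^]\<^bsub>k\<^esub> card B) = \<iota> (?b \<otimes>\<^bsub>k\<^esub> ?e [^]\<^bsub>k\<^esub> card A)" .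
  moreover have "\<one>\<^bsub>Q\<^esub> \<in> \<iota> ` carrier k"
    using \<iota>.hom_one by (metis image_eqI k.one_closed)
  then have "\<iota> ` carrier k \<noteq> {\<zero>\<^bsub>Q\<^esub>}"
    using Q.one_not_zero by (metis singletonD)
  then have "inj_on \<iota> (carrier k)"
    using ring_hom_ring.non_trivial_field_hom_imp_inj[OF
        ring_hom_ringI2[OF k.ring_axioms Q.ring_axioms \<iota>] k] by simp
  ultimately have "?a \<otimes>\<^bsub>k\<^esub> ?e [^]\<^bsub>k\<^esub> card B = ?b \<otimes>\<^bsub>k\<^esub> ?e [^]\<^bsub>k\<^esub> card A"
    by (elim inj_onD[rotated]) (use ab in simp_all)
  \<comment> \<open>Powers of -1 are their own inverses, so the sign moves to the other side and the
    exponents add up to \<open>card S\<close>.\<close>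
  moreover have "?e [^]\<^bsub>k\<^esub> card B \<otimes>\<^bsub>k\<^esub> ?e [^]\<^bsub>k\<^esub> card B = \<one>\<^bsub>k\<^esub>"
    using k.nat_pow_distrib[of ?e ?e "card B"] by (simp add: k.l_minus k.r_minus)
  ultimately have "?a = ?b \<otimes>\<^bsub>k\<^esub> (?e [^]\<^bsub>k\<^esub> card A \<otimes>\<^bsub>k\<^esub> ?e [^]\<^bsub>k\<^esub> card B)"
    using ab by (metis e k.m_assoc k.nat_pow_closed k.r_one)
  then have a: "?a = ?b \<otimes>\<^bsub>k\<^esub> ?e [^]\<^bsub>k\<^esub> card S"
    using AB AB'(1) fin by (simp add: k.nat_pow_mult card_Un_disjoint)
  have pow1: "p i [^]\<^bsub>k\<^esub> \<epsilon> i = p i" if "i \<in> A" for i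
    using that pc(1)[OF AB'(2)] unfolding A_def by (simp add: int_pow_def2 Pi_iff)
  have pow2: "p i [^]\<^bsub>k\<^esub> \<epsilon> i = inv\<^bsub>k\<^esub> (p i)" if "i \<in> B" for i
    using that pc(1)[OF AB'(3)] unfolding B_def by (simp add: int_pow_def2 Pi_iff)
  have c: "p \<in> A \<rightarrow> carrier k" "(\<lambda>i. inv\<^bsub>k\<^esub> (p i)) \<in> B \<rightarrow> carrier k"
    using pc(1)[OF AB'(2)] pc(2)[OF AB'(3)] k.Units_inv_closed by (simp_all add: Pi_iff)
  have "(\<Otimes>\<^bsub>k\<^esub>i\<in>S. p i [^]\<^bsub>k\<^esub> \<epsilon> i) =
      (\<Otimes>\<^bsub>k\<^esub>i\<in>A. p i [^]\<^bsub>k\<^esub> \<epsilon> i) \<otimes>\<^bsub>k\<^esub> (\<Otimes>\<^bsub>k\<^esub>i\<in>B. p i [^]\<^bsub>k\<^esub> \<epsilon> i)"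
    unfolding AB using fin AB'(1) c pow1 pow2 by (intro k.finprod_Un_disjoint) (simp_all add: Pi_iff)
  also have "(\<Otimes>\<^bsub>k\<^esub>i\<in>A. p i [^]\<^bsub>k\<^esub> \<epsilon> i) = ?a"
    using c(1) pow1 by (intro k.finprod_cong') auto
  also have "(\<Otimes>\<^bsub>k\<^esub>i\<in>B. p i [^]\<^bsub>k\<^esub> \<epsilon> i) = (\<Otimes>\<^bsub>k\<^esub>i\<in>B. inv\<^bsub>k\<^esub> (p i))"
    using c(2) pow2 by (intro k.finprod_cong') auto
  also have "\<dots> = inv\<^bsub>k\<^esub> ?b"
    by (rule k.finprod_inv) (rule pc(2)[OF AB'(3)])
  also have "?a \<otimes>\<^bsub>k\<^esub> inv\<^bsub>k\<^esub> ?b = ?e [^]\<^bsub>k\<^esub> card S"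
    unfolding a k.m_comm[OF ab(2) k.nat_pow_closed[OF e]] using ab(2,3) e by (simp add: k.m_assoc)
  finally show ?thesis .
qed

section \<open>Freeness\<close>

context matched_tree
begin

lemma torus_fixing_point_trivial:
  assumes k: "field k" and R: "algebra k R"
    and l: "l \<in> carrier (generic_torus V E \<phi> R)"
    and x: "(x, x', a) \<in> tree_variety k V E \<phi> M \<alpha> R"
    and fixed: "\<And>i. i \<in> V \<Longrightarrow> l i \<otimes>\<^bsub>R\<^esub> x i = x i"
    and \<alpha>: "\<forall>u \<in> status_vertices V E \<phi> Generic - \<Union>M. \<alpha> u \<in> Units k"
    and generic: "\<forall>C \<in> rg_components V E. \<phi> C = Generic \<longrightarrow> generic_parameters k V E M \<alpha> C"
    and i0: "i0 \<in> V"
  shows "l i0 = \<one>\<^bsub>R\<^esub>"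
proof (rule ccontr)
  assume i0_neq: "l i0 \<noteq> \<one>\<^bsub>R\<^esub>"
  interpret k: field k by fact
  interpret R: cring R
    using R by (rule algebra.M_cring)
  note l' = l[unfolded carrier_generic_torus]
  have l_Units: "l i \<in> Units R" and l_carrier: "l i \<in> carrier R" if "i \<in> V" for i
    using l' that by auto
  have x_carrier: "x i \<in> carrier R" "x' i \<in> carrier R" if "i \<in> V" for i
    using x that by (auto simp: tree_variety_def)
  have i0_red: "i0 \<in> red V E"
    using generic_torus_off_red[OF R.is_cring l i0] i0_neq by auto
  have "i0 \<in> status_vertices V E \<phi> Generic"
    using l' i0 i0_neq by auto
  then obtain C where C: "C \<in> rg_components V E" "\<phi> C = Generic" "i0 \<in> C"
    by (auto simp: status_vertices_def)
  then have C_generic: "i \<in> status_vertices V E \<phi> Generic" if "i \<in> C" for i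
    using that by (auto simp: status_vertices_def)
  have C_V: "C \<subseteq> V"
    using rg_component_subset[OF C(1)] red_subset green_subset by auto

  define F where "F i = {s \<in> carrier R. s \<otimes>\<^bsub>R\<^esub> l i = s}" for i
  have "ideal (F i0) R"
    unfolding F_def by (rule R.fixing_ideal[OF l_carrier[OF i0]])
  moreover have "\<one>\<^bsub>R\<^esub> \<notin> F i0"
    using i0_neq l_carrier[OF i0] by (simp add: F_def)
  ultimately obtain Q :: "'c set ring" and h where
    Q: "field Q" and h: "h \<in> ring_hom R Q" and h0: "\<And>s. s \<in> F i0 \<Longrightarrow> h s = \<zero>\<^bsub>Q\<^esub>"
    using R.residue_field_hom by blast
  interpret Q: field Q by fact
  interpret h: ring_hom_cring R Q h
    using h R.is_cring Q.is_cring by (simp add: ring_hom_cring_def ring_hom_cring_axioms_def)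

  \<comment> \<open>The kernel of \<open>h\<close> is prime, and \<open>F i\<close> lies inside it
    exactly if \<open>l i\<close> differs from 1 in the localization of \<open>R\<close> at this
    kernel. This can happen although \<open>h (l i)\<close> is 1.\<close>
  define Z where "Z = {i \<in> C \<inter> red V E. \<forall>s\<in>F i. h s = \<zero>\<^bsub>Q\<^esub>}"
  have Z_V: "i \<in> V" if "i \<in> Z" for i
    using that C_V unfolding Z_def by auto
  have x_Z: "h (x i) = \<zero>\<^bsub>Q\<^esub>" if "i \<in> Z" for i
  proof -
    have "x i \<in> F i"
      using fixed[OF Z_V[OF that]] x_carrier[OF Z_V[OF that]] l_carrier[OF Z_V[OF that]]
      by (simp add: F_def R.m_comm)
    then show ?thesis
      using that by (simp add: Z_def)
  qed

  have "i0 \<in> Z"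
    using C(3) i0_red h0 by (simp add: Z_def)
  \<comment> \<open>If \<open>i\<close> were the only neighbor of \<open>g\<close> in
    \<open>Z\<close>, each other neighbor \<open>j\<close> would have a witness \<open>s j\<close>
    in \<open>F j\<close> outside the kernel. The product of the witnesses is unchanged by the
    product of the \<open>l j\<close>, which is the inverse of \<open>l i\<close> by the equation at
    \<open>g\<close>; hence it lies in \<open>F i\<close>. As its image in the field is nonzero,
    this contradicts \<open>i\<close> being in \<open>Z\<close>.\<close>
  have other: "\<exists>j\<in>Z. j \<in> neighbors E g \<and> j \<noteq> i" if i: "i \<in> Z" "g \<in> neighbors E i" for g i
  proof (rule ccontr)
    assume none: "\<not> (\<exists>j\<in>Z. j \<in> neighbors E g \<and> j \<noteq> i)"
    let ?N = "neighbors E g - {i}"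
    have g: "g \<in> V" "i \<in> neighbors E g" "g \<in> C"
      using i neighbors_subset neighbors_sym rg_component_neighbor[OF C(1), of i g] by (auto simp: Z_def)
    have "\<exists>s. s \<in> F j \<and> h s \<noteq> \<zero>\<^bsub>Q\<^esub>" if j: "j \<in> ?N" for j
    proof (cases "j \<in> red V E")
      case False
      then have "l j = \<one>\<^bsub>R\<^esub>"
        using generic_torus_off_red[OF R.is_cring l] j neighbors_subset by auto
      then have "\<one>\<^bsub>R\<^esub> \<in> F j"
        by (simp add: F_def)
      then show ?thesis
        using Q.one_not_zero by (intro exI[of _ "\<one>\<^bsub>R\<^esub>"]) simp
    next
      case True
      then have "j \<in> C"
        using rg_component_neighbor[OF C(1) True, of g] g j neighbors_sym by auto
      moreover have "j \<notin> Z"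
        using none j by auto
      ultimately show ?thesis
        using True by (auto simp: Z_def)
    qed
    then obtain s where s: "\<And>j. j \<in> ?N \<Longrightarrow> s j \<in> F j" "\<And>j. j \<in> ?N \<Longrightarrow> h (s j) \<noteq> \<zero>\<^bsub>Q\<^esub>"
      by metis
    have s_carrier: "s \<in> ?N \<rightarrow> carrier R"
      using s(1) by (auto simp: F_def)
    have l_N: "l \<in> ?N \<rightarrow> carrier R" "l \<in> neighbors E g \<rightarrow> carrier R"
      using l_carrier neighbors_subset by auto
    let ?s = "finprod R s ?N" and ?l = "finprod R l ?N"
    have c: "?s \<in> carrier R" "?l \<in> carrier R" "l i \<in> carrier R"
      using s_carrier l_N l_carrier[OF Z_V[OF i(1)]] by auto
    have "?s \<otimes>\<^bsub>R\<^esub> ?l = (\<Otimes>\<^bsub>R\<^esub>j\<in>?N. s j \<otimes>\<^bsub>R\<^esub> l j)"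
      using R.finprod_multf[OF s_carrier l_N(1)] by simp
    also have "\<dots> = ?s"
      using s(1) s_carrier by (intro R.finprod_cong') (auto simp: F_def)
    finally have sl: "?s \<otimes>\<^bsub>R\<^esub> ?l = ?s" .
    have "l i \<otimes>\<^bsub>R\<^esub> ?l = \<one>\<^bsub>R\<^esub>"
      using R.finprod_remove[OF finite_neighbors g(2) l_N(2)] l' g(1) by simp
    then have "(?s \<otimes>\<^bsub>R\<^esub> ?l) \<otimes>\<^bsub>R\<^esub> l i = ?s"
      using c by (simp add: R.m_assoc R.m_comm[of ?l "l i"])
    then have "?s \<in> F i"
      using sl c by (simp add: F_def)
    then have "h ?s = \<zero>\<^bsub>Q\<^esub>"
      using i(1) by (simp add: Z_def)
    moreover have "h ?s = (\<Otimes>\<^bsub>Q\<^esub>j\<in>?N. h (s j))"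
      using h.hom_finprod[OF s_carrier] by (simp add: comp_def)
    moreover have "(\<Otimes>\<^bsub>Q\<^esub>j\<in>?N. h (s j)) \<noteq> \<zero>\<^bsub>Q\<^esub>"
      using s(2) s_carrier by (intro Q.finprod_nonzero) (simp add: Pi_iff)
    ultimately show False by simp
  qed
  have "Z \<subseteq> C \<inter> red V E"
    unfolding Z_def by auto
  from admissible_exists[OF C(1) this \<open>i0 \<in> Z\<close> other] obtain S and \<epsilon> :: "'v \<Rightarrow> int" where
    S: "admissible V E C S" "S \<subseteq> Z" "\<epsilon> ` S \<subseteq> {1, -1}"
    and alternate: "\<And>i j g. i \<in> S \<Longrightarrow> j \<in> S \<Longrightarrow> i \<noteq> j \<Longrightarrow> i \<in> neighbors E g \<Longrightarrow> j \<in> neighbors E g \<Longrightarrow> \<epsilon> i = - \<epsilon> j"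
    by metis
  have S_C: "i \<in> C" "i \<in> red V E" "i \<in> V" "i \<in> Z" if "i \<in> S" for i
    using that S(2) Z_V unfolding Z_def by auto
  let ?p = "parameter k M \<alpha>"
  have "(\<Otimes>\<^bsub>k\<^esub>i\<in>S. ?p i [^]\<^bsub>k\<^esub> \<epsilon> i) = (\<ominus>\<^bsub>k\<^esub> \<one>\<^bsub>k\<^esub>) [^]\<^bsub>k\<^esub> card S"
  proof (rule alternating_product[OF k Q algebra_structure_hom[OF R h]])
    show "finite S"
      using S_C(3) finite_V by (metis finite_subset subsetI)
    show "\<epsilon> ` S \<subseteq> {1, -1}" by fact
    show p: "?p \<in> S \<rightarrow> Units k"
      using \<alpha> C_generic S_C(1) by (auto simp: parameter_def)
    show "finite (neighbors E i)" for i by simp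
    show "(\<lambda>j. h (x j)) \<in> neighbors E i \<rightarrow> carrier Q" for i
      using x_carrier neighbors_subset[of i] by auto
    fix i assume i: "i \<in> S"
    show "h (?p i \<odot>\<^bsub>R\<^esub> \<one>\<^bsub>R\<^esub>) \<otimes>\<^bsub>Q\<^esub> (\<Otimes>\<^bsub>Q\<^esub>j\<in>neighbors E i. h (x j)) = \<ominus>\<^bsub>Q\<^esub> \<one>\<^bsub>Q\<^esub>"
    proof -
      let ?c = "?p i \<odot>\<^bsub>R\<^esub> \<one>\<^bsub>R\<^esub>" and ?X = "\<Otimes>\<^bsub>R\<^esub>j\<in>neighbors E i. x j"
      \<comment> \<open>\<open>C\<close> is generic, so the coefficient at \<open>i\<close> is the
        image of an element of k and not a coordinate of the point.\<close>
      have "i \<notin> versal_uncovered V E \<phi> M"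
        using generic_not_versal[OF C_generic[OF S_C(1)[OF i]]] by (simp add: versal_uncovered_def)
      then have eq: "x i \<otimes>\<^bsub>R\<^esub> x' i = \<one>\<^bsub>R\<^esub> \<oplus>\<^bsub>R\<^esub> ?c \<otimes>\<^bsub>R\<^esub> ?X"
        using x S_C(3)[OF i] by (simp add: tree_variety_def coefficient_def)
      have xN: "x \<in> neighbors E i \<rightarrow> carrier R"
        using x_carrier neighbors_subset[of i] by auto
      have c: "?c \<in> carrier R" "?X \<in> carrier R"
        using p i R xN by (auto simp: algebra_def intro!: module.smult_closed)
      have "h (x i \<otimes>\<^bsub>R\<^esub> x' i) = \<zero>\<^bsub>Q\<^esub>"
        using x_Z[OF S_C(4)[OF i]] x_carrier[OF S_C(3)[OF i]] by simp
      then have "\<one>\<^bsub>Q\<^esub> \<oplus>\<^bsub>Q\<^esub> h ?c \<otimes>\<^bsub>Q\<^esub> h ?X = \<zero>\<^bsub>Q\<^esub>"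
        using c unfolding eq by simp
      then have "h ?c \<otimes>\<^bsub>Q\<^esub> h ?X = \<ominus>\<^bsub>Q\<^esub> \<one>\<^bsub>Q\<^esub>"
        using c Q.minus_equality[of "h ?c \<otimes>\<^bsub>Q\<^esub> h ?X" "\<one>\<^bsub>Q\<^esub>"] Q.a_comm by simp
      moreover have "h ?X = (\<Otimes>\<^bsub>Q\<^esub>j\<in>neighbors E i. h (x j))"
        using h.hom_finprod[OF xN] by (simp add: comp_def)
      ultimately show ?thesis by simp
    qed
    \<comment> \<open>A common neighbor would force opposite signs, and neither 1 nor -1 is its own
      negative.\<close>
    show "neighbors E i \<inter> neighbors E j = {}" if j: "j \<in> S" "i \<noteq> j" "\<epsilon> i = \<epsilon> j" for j
    proof (rule ccontr)
      assume "neighbors E i \<inter> neighbors E j \<noteq> {}"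
      then obtain g where "g \<in> neighbors E i" "g \<in> neighbors E j" by auto
      then have "\<epsilon> i = - \<epsilon> j"
        using alternate[OF i j(1,2), of g] neighbors_sym by metis
      then show False
        using j(3) S(3) i by auto
    qed
    \<comment> \<open>Admissibility turns the one known neighbor \<open>i\<close> of
      \<open>g\<close> in \<open>S\<close> into exactly two, and the second has the opposite
      sign.\<close>
    show "\<exists>j\<in>S. \<epsilon> j = - \<epsilon> i \<and> g \<in> neighbors E j" if g: "g \<in> neighbors E i" for g
    proof -
      have ig: "i \<in> neighbors E g \<inter> S"
        using g i neighbors_sym by auto
      have "g \<in> C \<inter> green V E"
        using red_neighbor_green[OF S_C(2)[OF i] g] rg_component_neighbor[OF C(1) S_C(2)[OF i] g]
          S_C(1)[OF i] by simp
      then have "card (neighbors E g \<inter> S) \<in> {0, 2}"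
        using S(1) by (simp add: admissible_def)
      moreover have "card (neighbors E g \<inter> S) \<noteq> 0"
        using ig by auto
      ultimately have "card (neighbors E g \<inter> S) = 2"
        by simp
      then obtain u v where uv: "neighbors E g \<inter> S = {u, v}" "u \<noteq> v"
        by (meson card_2_iff)
      then obtain j where j: "j \<in> neighbors E g \<inter> S" "j \<noteq> i"
        by (cases "u = i") auto
      then have "\<epsilon> j = - \<epsilon> i" "g \<in> neighbors E j"
        using alternate[of j i g] ig neighbors_sym by auto
      then show ?thesis
        using j by auto
    qed
  qed
  moreover have "(\<Otimes>\<^bsub>k\<^esub>i\<in>S. ?p i [^]\<^bsub>k\<^esub> \<epsilon> i) \<noteq> (\<ominus>\<^bsub>k\<^esub> \<one>\<^bsub>k\<^esub>) [^]\<^bsub>k\<^esub> card S"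
  proof -
    have "generic_parameters k V E M \<alpha> C"
      using generic C by simp
    note * = this[unfolded generic_parameters_def, rule_format, OF S(1) S(3)]
    show ?thesis
    proof (rule *)
      fix i j assume "i \<in> S" "j \<in> S"
        "i \<noteq> j \<and> (\<exists>g\<in>green V E. i \<in> neighbors E g \<and> j \<in> neighbors E g)"
      then show "\<epsilon> i = - \<epsilon> j"
        using alternate by metis
    qed
  qed
  ultimately show False
    by (rule notE[rotated])
qed

end

section \<open>The torus action\<close>

text \<open>The inverse group element provides the inverse map, so pointwise laws suffice. Elements
  of \<open>BijGroup X0\<close> are compared as functions, whence the demand
  \<open>ext\<close>.\<close>

lemma group_actionI:
  assumes "group G"
    and closed: "\<And>g x. g \<in> carrier G \<Longrightarrow> x \<in> X0 \<Longrightarrow> act g x \<in> X0"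
    and ext: "\<And>g. g \<in> carrier G \<Longrightarrow> act g \<in> extensional X0"
    and one: "\<And>x. x \<in> X0 \<Longrightarrow> act \<one>\<^bsub>G\<^esub> x = x"
    and mult: "\<And>g h x. g \<in> carrier G \<Longrightarrow> h \<in> carrier G \<Longrightarrow> x \<in> X0 \<Longrightarrow>
      act (g \<otimes>\<^bsub>G\<^esub> h) x = act g (act h x)"
  shows "group_action G X0 act"
proof -
  interpret G: group G by fact
  have Bij: "act g \<in> Bij X0" if g: "g \<in> carrier G" for g
  proof -
    have "bij_betw (act g) X0 X0"
    proof (rule bij_betw_byWitness[where f' = "act (inv\<^bsub>G\<^esub> g)"])
      show "\<forall>x\<in>X0. act (inv\<^bsub>G\<^esub> g) (act g x) = x" "\<forall>x\<in>X0. act g (act (inv\<^bsub>G\<^esub> g) x) = x"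
        using mult[OF G.inv_closed[OF g] g, symmetric] mult[OF g G.inv_closed[OF g], symmetric]
          one g by simp_all
      show "act g ` X0 \<subseteq> X0" "act (inv\<^bsub>G\<^esub> g) ` X0 \<subseteq> X0"
        using closed g by auto
    qed
    then show ?thesis
      using ext[OF g] by (simp add: Bij_def)
  qed
  have "act (g \<otimes>\<^bsub>G\<^esub> h) = act g \<otimes>\<^bsub>BijGroup X0\<^esub> act h" if "g \<in> carrier G" "h \<in> carrier G" for g h
  proof -
    have "act (g \<otimes>\<^bsub>G\<^esub> h) = compose X0 (act g) (act h)"
      using ext that mult by (intro extensionalityI[of _ X0]) (auto simp: compose_def)
    then show ?thesis
      using Bij that by (simp add: BijGroup_def)
  qed
  then have "act \<in> hom G (BijGroup X0)"
    using Bij by (intro homI) (auto simp: BijGroup_def)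
  then show ?thesis
    using G.is_group group_BijGroup[of X0]
    by (simp add: group_action_def group_hom_def group_hom_axioms_def)
qed

context matched_tree
begin

text \<open>Restriction \<rho> to the uncovered generic vertices is visibly compatible with algebra
  homomorphisms, and its inverse \<open>\<theta>\<close> inherits this by injectivity of \<rho>. The
  recursion behind \<open>generic_torus_extend\<close> thus need not be followed through a
  homomorphism.\<close>

lemma generic_torus_is_torus:
  "is_torus k (generic_torus V E \<phi> :: ('k, 'r) module \<Rightarrow> _) (map_family V)
    (card (status_vertices V E \<phi> Generic - \<Union>M))"
proof -
  let ?U = "status_vertices V E \<phi> Generic - \<Union>M"
  let ?\<Lambda> = "generic_torus V E \<phi>"
  let ?d = "card ?U"
  have U_V: "?U \<subseteq> V"
    using status_vertices_subset[of \<phi> Generic] red_subset green_subset by auto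
  \<comment> \<open>One enumeration serves all algebras; naturality of \<open>\<theta>\<close> rests
    on it.\<close>
  obtain idx where idx: "bij_betw idx {..<?d} ?U"
    using ex_bij_betw_nat_finite[OF finite_subset[OF U_V finite_V]] by (auto simp: atLeast0LessThan)
  then have idx_U: "idx n \<in> ?U" "idx n \<in> V" if "n < ?d" for n
    using that U_V by (auto simp: bij_betw_def)
  define \<rho> :: "('v \<Rightarrow> 'r) \<Rightarrow> nat \<Rightarrow> 'r" where "\<rho> l = (\<lambda>n\<in>{..<?d}. l (idx n))" for l
  define \<theta> :: "('k, 'r) module \<Rightarrow> (nat \<Rightarrow> 'r) \<Rightarrow> 'v \<Rightarrow> 'r" where "\<theta> R = inv_into (carrier (?\<Lambda> R)) \<rho>" for R
  have iso: "\<rho> \<in> iso (?\<Lambda> R) (Gm_power {..<?d} R)" if R: "cring R" for R :: "('k, 'r) module"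
  proof -
    have "\<rho> \<in> hom (?\<Lambda> R) (Gm_power {..<?d} R)"
    proof (rule homI)
      fix l m assume l: "l \<in> carrier (?\<Lambda> R)"
      then show "\<rho> l \<in> carrier (Gm_power {..<?d} R)"
        using idx_U by (auto simp: \<rho>_def carrier_Gm_power carrier_generic_torus)
      show "\<rho> (l \<otimes>\<^bsub>?\<Lambda> R\<^esub> m) = \<rho> l \<otimes>\<^bsub>Gm_power {..<?d} R\<^esub> \<rho> m"
        using idx_U(2) unfolding \<rho>_def mult_generic_torus mult_Gm_power
        by (intro restrict_ext) simp
    qed
    moreover have "bij_betw \<rho> (carrier (?\<Lambda> R)) (carrier (Gm_power {..<?d} R))"
      unfolding bij_betw_def
    proof
      show "inj_on \<rho> (carrier (?\<Lambda> R))"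
      proof (rule inj_onI)
        fix l m assume lm: "l \<in> carrier (?\<Lambda> R)" "m \<in> carrier (?\<Lambda> R)" "\<rho> l = \<rho> m"
        show "l = m"
        proof (rule generic_torus_eqI[OF R lm(1,2)])
          fix i assume "i \<in> ?U"
          then obtain n where "n < ?d" "i = idx n"
            using bij_betw_imp_surj_on[OF idx] by (metis imageE lessThan_iff)
          then show "l i = m i"
            using fun_cong[OF lm(3), of n] by (simp add: \<rho>_def)
        qed
      qed
      show "\<rho> ` carrier (?\<Lambda> R) = carrier (Gm_power {..<?d} R)"
      proof
        show "\<rho> ` carrier (?\<Lambda> R) \<subseteq> carrier (Gm_power {..<?d} R)"
          using calculation by (auto simp: hom_def)
        show "carrier (Gm_power {..<?d} R) \<subseteq> \<rho> ` carrier (?\<Lambda> R)"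
        proof
          fix t assume "t \<in> carrier (Gm_power {..<?d} R)"
          then have t: "t \<in> {..<?d} \<rightarrow>\<^sub>E Units R"
            by (simp add: carrier_Gm_power)
          define t' where "t' i = t (inv_into {..<?d} idx i)" for i
          have t'_idx: "t' (idx n) = t n" if "n < ?d" for n
            using that idx by (simp add: t'_def bij_betw_def)
          have "t' i \<in> Units R" if i: "i \<in> ?U" for i
          proof -
            obtain n where "n < ?d" "i = idx n"
              using i bij_betw_imp_surj_on[OF idx] by (metis imageE lessThan_iff)
            then show ?thesis
              using t'_idx t by auto
          qed
          then have "t' \<in> ?U \<rightarrow> Units R" by (rule Pi_I)
          from generic_torus_extend[OF R this]
          obtain l where l: "l \<in> carrier (?\<Lambda> R)" "\<forall>i\<in>?U. l i = t' i"
            by (elim bexE)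
          have "\<rho> l = t"
          proof (rule PiE_ext[of _ "{..<?d}" "\<lambda>_. UNIV"])
            show "\<rho> l n = t n" if "n \<in> {..<?d}" for n
              using that l(2) idx_U(1)[of n] t'_idx[of n] by (simp add: \<rho>_def)
            show "t \<in> {..<?d} \<rightarrow>\<^sub>E UNIV"
              using t by (auto simp: PiE_iff)
          qed (simp add: \<rho>_def)
          then show "t \<in> \<rho> ` carrier (?\<Lambda> R)"
            using l(1) by (metis imageI)
        qed
      qed
    qed
    ultimately show ?thesis
      by (simp add: Group.iso_def)
  qed
  have \<theta>_iso: "\<theta> R \<in> iso (Gm_power {..<?d} R) (?\<Lambda> R)" if "cring R" for R :: "('k, 'r) module"
    unfolding \<theta>_def by (rule group.iso_set_sym[OF group_generic_torus[OF that] iso[OF that]])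
  have natural: "\<theta> S (map_family {..<?d} f t) = map_family V f (\<theta> R t)"
    if RS: "cring R" "cring S" and f: "f \<in> ring_hom R S" and t: "t \<in> carrier (Gm_power {..<?d} R)"
    for R S :: "('k, 'r) module" and f t
  proof -
    have bij: "bij_betw \<rho> (carrier (?\<Lambda> R)) (carrier (Gm_power {..<?d} R))"
      using iso[OF RS(1)] by (simp add: Group.iso_def)
    have "inj_on \<rho> (carrier (?\<Lambda> S))"
      using iso[OF RS(2)] by (simp add: Group.iso_def bij_betw_def)
    have l: "\<theta> R t \<in> carrier (?\<Lambda> R)" "\<rho> (\<theta> R t) = t"
      unfolding \<theta>_def using bij_betw_inv_into_right[OF bij t] bij_betwE[OF bij_betw_inv_into[OF bij]] t
      by auto
    have "map_family {..<?d} f t n = \<rho> (map_family V f (\<theta> R t)) n" for n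
      using idx_U(2)[of n] fun_cong[OF l(2), of n] by (auto simp: \<rho>_def map_family_def)
    then have "map_family {..<?d} f t = \<rho> (map_family V f (\<theta> R t))" by (rule ext)
    then show ?thesis
      using inv_into_f_f[OF \<open>inj_on \<rho> (carrier (?\<Lambda> S))\<close> map_generic_torus[OF RS f l(1)]]
      unfolding \<theta>_def[of S] by simp
  qed
  show ?thesis
    unfolding is_torus_def
  proof (intro exI[of _ \<theta>] conjI allI impI ballI)
    show "\<theta> R \<in> iso (Gm_power {..<?d} R) (?\<Lambda> R)" if "algebra k R" for R
      using algebra.M_cring[OF that] by (rule \<theta>_iso)
    show "\<theta> S (map_family {..<?d} f t) = map_family V f (\<theta> R t)"
      if "algebra k R" "algebra k S" "f \<in> alg_hom k R S" "t \<in> carrier (Gm_power {..<?d} R)"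
      for R S f t
    proof (rule natural[OF algebra.M_cring[OF that(1)] algebra.M_cring[OF that(2)] _ that(4)])
      show "f \<in> ring_hom R S"
        using that(3) by (simp add: alg_hom_def)
    qed
  qed
qed

section \<open>The action on points and its compatibility with algebra homomorphisms\<close>

lemma torus_action_apply:
  "(x, x', a) \<in> tree_variety k V E \<phi> M \<alpha> R \<Longrightarrow> torus_action k V E \<phi> M \<alpha> R l (x, x', a) =
     (\<lambda>i\<in>V. l i \<otimes>\<^bsub>R\<^esub> x i, \<lambda>i\<in>V. inv\<^bsub>R\<^esub> (l i) \<otimes>\<^bsub>R\<^esub> x' i, a)"
  by (simp add: torus_action_def)

text \<open>The left side of the equation at \<open>i\<close> keeps its value because
  \<open>l i\<close> meets its inverse, the right side because the values of \<open>l\<close> at the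
  neighbors of \<open>i\<close> multiply to 1.\<close>

lemma torus_action_closed:
  assumes R: "cring R" and l: "l \<in> carrier (generic_torus V E \<phi> R)"
    and p: "p \<in> tree_variety k V E \<phi> M \<alpha> R"
  shows "torus_action k V E \<phi> M \<alpha> R l p \<in> tree_variety k V E \<phi> M \<alpha> R"
proof -
  interpret R: cring R by fact
  obtain x x' a where p_eq: "p = (x, x', a)" by (cases p)
  note p' = p[unfolded p_eq]
  then have x: "x \<in> V \<rightarrow>\<^sub>E carrier R" "x' \<in> V \<rightarrow>\<^sub>E carrier R"
      "a \<in> versal_uncovered V E \<phi> M \<rightarrow>\<^sub>E Units R"
      "\<forall>i\<in>V. x i \<otimes>\<^bsub>R\<^esub> x' i =
        \<one>\<^bsub>R\<^esub> \<oplus>\<^bsub>R\<^esub> coefficient k V E \<phi> M \<alpha> R a i \<otimes>\<^bsub>R\<^esub> finprod R x (neighbors E i)"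
    by (simp_all add: tree_variety_def)
  note l' = l[unfolded carrier_generic_torus]
  have lU: "l i \<in> Units R" if "i \<in> V" for i
    using l' that by auto
  have xN: "x \<in> neighbors E i \<rightarrow> carrier R" "l \<in> neighbors E i \<rightarrow> carrier R" for i
    using x(1) lU neighbors_subset[of i] by auto
  have "(l i \<otimes>\<^bsub>R\<^esub> x i) \<otimes>\<^bsub>R\<^esub> (inv\<^bsub>R\<^esub> (l i) \<otimes>\<^bsub>R\<^esub> x' i) = x i \<otimes>\<^bsub>R\<^esub> x' i" if "i \<in> V" for i
  proof -
    have c: "l i \<in> carrier R" "inv\<^bsub>R\<^esub> (l i) \<in> carrier R" "x i \<in> carrier R" "x' i \<in> carrier R"
      using lU[OF that] x(1,2) that by auto
    have "(l i \<otimes>\<^bsub>R\<^esub> x i) \<otimes>\<^bsub>R\<^esub> (inv\<^bsub>R\<^esub> (l i) \<otimes>\<^bsub>R\<^esub> x' i) =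
        (l i \<otimes>\<^bsub>R\<^esub> inv\<^bsub>R\<^esub> (l i)) \<otimes>\<^bsub>R\<^esub> (x i \<otimes>\<^bsub>R\<^esub> x' i)"
      using c by (simp add: R.m_ac)
    then show ?thesis
      using lU[OF that] c by simp
  qed
  moreover have "finprod R (\<lambda>i\<in>V. l i \<otimes>\<^bsub>R\<^esub> x i) (neighbors E i) = finprod R x (neighbors E i)"
    if "i \<in> V" for i
  proof -
    have "finprod R (\<lambda>i\<in>V. l i \<otimes>\<^bsub>R\<^esub> x i) (neighbors E i) = (\<Otimes>\<^bsub>R\<^esub>j\<in>neighbors E i. l j \<otimes>\<^bsub>R\<^esub> x j)"
      using xN[of i] neighbors_subset[of i] by (intro R.finprod_cong') auto
    also have "\<dots> = finprod R x (neighbors E i)"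
      using R.finprod_multf[OF xN(2) xN(1), of i] l' that R.finprod_closed[OF xN(1)] by simp
    finally show ?thesis .
  qed
  moreover have "l i \<otimes>\<^bsub>R\<^esub> x i \<in> carrier R" "inv\<^bsub>R\<^esub> (l i) \<otimes>\<^bsub>R\<^esub> x' i \<in> carrier R" if "i \<in> V" for i
    using lU[OF that] x(1,2) that by auto
  ultimately show ?thesis
    unfolding p_eq torus_action_apply[OF p'] using x(3,4) by (simp add: tree_variety_def)
qed

lemma torus_action_group_action:
  assumes R: "cring R"
  shows "group_action (generic_torus V E \<phi> R) (tree_variety k V E \<phi> M \<alpha> R) (torus_action k V E \<phi> M \<alpha> R)"
proof (rule group_actionI[OF group_generic_torus[OF R] torus_action_closed[OF R]])
  interpret R: cring R by fact
  show "torus_action k V E \<phi> M \<alpha> R l \<in> extensional (tree_variety k V E \<phi> M \<alpha> R)" for l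
    by (simp add: torus_action_def)
  fix p assume p: "p \<in> tree_variety k V E \<phi> M \<alpha> R"
  obtain x x' a where p_eq: "p = (x, x', a)" by (cases p)
  note p' = p[unfolded p_eq]
  have x: "x \<in> V \<rightarrow>\<^sub>E carrier R" "x' \<in> V \<rightarrow>\<^sub>E carrier R"
    using p' by (simp_all add: tree_variety_def)
  show "torus_action k V E \<phi> M \<alpha> R \<one>\<^bsub>generic_torus V E \<phi> R\<^esub> p = p"
    unfolding p_eq torus_action_apply[OF p'] one_generic_torus using x
    by (auto intro!: ext simp: PiE_iff extensional_def)
  fix l m assume lm: "l \<in> carrier (generic_torus V E \<phi> R)" "m \<in> carrier (generic_torus V E \<phi> R)"
  have "(l i \<otimes>\<^bsub>R\<^esub> m i) \<otimes>\<^bsub>R\<^esub> x i = l i \<otimes>\<^bsub>R\<^esub> (m i \<otimes>\<^bsub>R\<^esub> x i)"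
    "inv\<^bsub>R\<^esub> (l i \<otimes>\<^bsub>R\<^esub> m i) \<otimes>\<^bsub>R\<^esub> x' i = inv\<^bsub>R\<^esub> (l i) \<otimes>\<^bsub>R\<^esub> (inv\<^bsub>R\<^esub> (m i) \<otimes>\<^bsub>R\<^esub> x' i)" if "i \<in> V" for i
  proof -
    have U: "l i \<in> Units R" "m i \<in> Units R"
      using lm that by (auto simp: carrier_generic_torus)
    then have c: "l i \<in> carrier R" "inv\<^bsub>R\<^esub> (l i) \<in> carrier R" "m i \<in> carrier R" "inv\<^bsub>R\<^esub> (m i) \<in> carrier R"
      by auto
    have xc: "x i \<in> carrier R" "x' i \<in> carrier R"
      using x that by auto
    show "(l i \<otimes>\<^bsub>R\<^esub> m i) \<otimes>\<^bsub>R\<^esub> x i = l i \<otimes>\<^bsub>R\<^esub> (m i \<otimes>\<^bsub>R\<^esub> x i)"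
      using c xc by (simp add: R.m_assoc)
    have "(l i \<otimes>\<^bsub>R\<^esub> m i) \<otimes>\<^bsub>R\<^esub> (inv\<^bsub>R\<^esub> (l i) \<otimes>\<^bsub>R\<^esub> inv\<^bsub>R\<^esub> (m i)) =
        (l i \<otimes>\<^bsub>R\<^esub> inv\<^bsub>R\<^esub> (l i)) \<otimes>\<^bsub>R\<^esub> (m i \<otimes>\<^bsub>R\<^esub> inv\<^bsub>R\<^esub> (m i))"
      using c by (simp add: R.m_ac)
    then have "inv\<^bsub>R\<^esub> (l i \<otimes>\<^bsub>R\<^esub> m i) = inv\<^bsub>R\<^esub> (l i) \<otimes>\<^bsub>R\<^esub> inv\<^bsub>R\<^esub> (m i)"
      using U c by (intro R.comm_inv_char) simp_all
    then show "inv\<^bsub>R\<^esub> (l i \<otimes>\<^bsub>R\<^esub> m i) \<otimes>\<^bsub>R\<^esub> x' i = inv\<^bsub>R\<^esub> (l i) \<otimes>\<^bsub>R\<^esub> (inv\<^bsub>R\<^esub> (m i) \<otimes>\<^bsub>R\<^esub> x' i)"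
      using c xc by (simp add: R.m_assoc)
  qed
  then show "torus_action k V E \<phi> M \<alpha> R (l \<otimes>\<^bsub>generic_torus V E \<phi> R\<^esub> m) p =
      torus_action k V E \<phi> M \<alpha> R l (torus_action k V E \<phi> M \<alpha> R m p)"
    using torus_action_closed[OF R lm(2) p] unfolding p_eq torus_action_apply[OF p'] mult_generic_torus
    by (subst torus_action_apply) (auto intro!: restrict_ext)
qed

text \<open>Uncovered vertices are red, so each of them carries either a coefficient variable or one
  of the fixed parameters.\<close>

lemma red_status:
  assumes "i \<in> red V E"
  shows "i \<in> status_vertices V E \<phi> Generic \<or> i \<in> status_vertices V E \<phi> Versal"
proof -
  let ?C = "(rg_adjacent V E)\<^sup>* `` {i}"
  have "?C \<in> rg_components V E" "i \<in> ?C"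
    using assms unfolding rg_components_def by auto
  then show ?thesis
    unfolding status_vertices_def by (cases "\<phi> ?C") auto
qed

lemma tree_variety_map_closed:
  assumes R: "algebra k R" and S: "algebra k S" and f: "f \<in> alg_hom k R S"
    and k: "cring k"
    and \<alpha>: "\<And>i. i \<in> status_vertices V E \<phi> Generic - \<Union>M \<Longrightarrow> \<alpha> i \<in> carrier k"
    and p: "p \<in> tree_variety k V E \<phi> M \<alpha> R"
  shows "tree_variety_map V E \<phi> M f p \<in> tree_variety k V E \<phi> M \<alpha> S"
proof -
  interpret k: cring k by fact
  interpret R: algebra k R by fact
  interpret S: algebra k S by fact
  have hom: "f \<in> ring_hom R S"
    using f by (simp add: alg_hom_def)
  interpret f: ring_hom_cring R S f
    using hom R.M_cring S.M_cring by (simp add: ring_hom_cring_def ring_hom_cring_axioms_def)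
  obtain x x' a where p_eq: "p = (x, x', a)" by (cases p)
  then have x: "x \<in> V \<rightarrow>\<^sub>E carrier R" "x' \<in> V \<rightarrow>\<^sub>E carrier R"
      "a \<in> versal_uncovered V E \<phi> M \<rightarrow>\<^sub>E Units R"
      "\<forall>i\<in>V. x i \<otimes>\<^bsub>R\<^esub> x' i =
        \<one>\<^bsub>R\<^esub> \<oplus>\<^bsub>R\<^esub> coefficient k V E \<phi> M \<alpha> R a i \<otimes>\<^bsub>R\<^esub> finprod R x (neighbors E i)"
    using p by (simp_all add: tree_variety_def)
  let ?a = "map_family (versal_uncovered V E \<phi> M) f a"
  have units: "f (a i) \<in> Units S" "a i \<in> Units R" if "i \<in> versal_uncovered V E \<phi> M" for i
    using that x(3) ring_hom_Units(1)[OF R.M_cring S.M_cring hom] by auto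
  \<comment> \<open>Off the uncovered generic vertices \<alpha> is arbitrary and may leave the
    carrier of k, whereas \<open>f\<close> is linear for scalars in the carrier only.\<close>
  have param: "parameter k M \<alpha> i \<in> carrier k" if "i \<in> V" "i \<notin> versal_uncovered V E \<phi> M" for i
  proof (cases "i \<in> \<Union>M")
    case False
    then have "i \<in> red V E"
      using uncovered_red that(1) by simp
    then have "i \<in> status_vertices V E \<phi> Generic \<or> i \<in> status_vertices V E \<phi> Versal"
      by (rule red_status)
    then have "i \<in> status_vertices V E \<phi> Generic - \<Union>M"
      using that(2) False by (auto simp: versal_uncovered_def)
    then show ?thesis
      using \<alpha> False by (simp add: parameter_def)
  qed (simp add: parameter_def)
  have coeff: "coefficient k V E \<phi> M \<alpha> R a i \<in> carrier R"
    "f (coefficient k V E \<phi> M \<alpha> R a i) = coefficient k V E \<phi> M \<alpha> S ?a i" if "i \<in> V" for i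
    using that param[OF that] f units(2)[of i] hom
    by (auto simp: coefficient_def map_family_def alg_hom_def)
  have "f (x i) \<otimes>\<^bsub>S\<^esub> f (x' i) = \<one>\<^bsub>S\<^esub> \<oplus>\<^bsub>S\<^esub> coefficient k V E \<phi> M \<alpha> S ?a i \<otimes>\<^bsub>S\<^esub>
      finprod S (map_family V f x) (neighbors E i)" if i: "i \<in> V" for i
  proof -
    have c: "x i \<in> carrier R" "x' i \<in> carrier R" and xN: "x \<in> neighbors E i \<rightarrow> carrier R"
      using x(1,2) i neighbors_subset[of i] by auto
    have "finprod S (map_family V f x) (neighbors E i) = (\<Otimes>\<^bsub>S\<^esub>j\<in>neighbors E i. f (x j))"
      using xN neighbors_subset[of i] by (intro S.finprod_cong') (auto simp: map_family_def)
    also have "\<dots> = f (finprod R x (neighbors E i))"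
      using f.hom_finprod[OF xN] by (simp add: comp_def)
    finally have "\<one>\<^bsub>S\<^esub> \<oplus>\<^bsub>S\<^esub> coefficient k V E \<phi> M \<alpha> S ?a i \<otimes>\<^bsub>S\<^esub> finprod S (map_family V f x) (neighbors E i) =
        f (\<one>\<^bsub>R\<^esub> \<oplus>\<^bsub>R\<^esub> coefficient k V E \<phi> M \<alpha> R a i \<otimes>\<^bsub>R\<^esub> finprod R x (neighbors E i))"
      using coeff[OF i] R.finprod_closed[OF xN] by simp
    also have "\<dots> = f (x i) \<otimes>\<^bsub>S\<^esub> f (x' i)"
      using x(4) i c by (metis f.hom_mult)
    finally show ?thesis ..
  qed
  moreover have "f (x i) \<in> carrier S" "f (x' i) \<in> carrier S" if "i \<in> V" for i
    using x(1,2) that by auto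
  ultimately show ?thesis
    using units(1) unfolding p_eq by (simp add: tree_variety_def tree_variety_map_def map_family_def)
qed

text \<open>\<open>torus_action\<close> is a function restricted to the points of the variety, so
  evaluating it at the image of \<open>p\<close> calls for \<open>fp\<close>.\<close>

lemma torus_action_natural:
  assumes R: "cring R" and S: "cring S" and f: "f \<in> ring_hom R S"
    and l: "l \<in> carrier (generic_torus V E \<phi> R)"
    and p: "p \<in> tree_variety k V E \<phi> M \<alpha> R"
    and fp: "tree_variety_map V E \<phi> M f p \<in> tree_variety k V E \<phi> M \<alpha> S"
  shows "tree_variety_map V E \<phi> M f (torus_action k V E \<phi> M \<alpha> R l p) =
    torus_action k V E \<phi> M \<alpha> S (map_family V f l) (tree_variety_map V E \<phi> M f p)"
proof -
  interpret R: cring R by fact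
  interpret S: cring S by fact
  obtain x x' a where p_eq: "p = (x, x', a)" by (cases p)
  have "f (l i \<otimes>\<^bsub>R\<^esub> x i) = f (l i) \<otimes>\<^bsub>S\<^esub> f (x i)"
    "f (inv\<^bsub>R\<^esub> (l i) \<otimes>\<^bsub>R\<^esub> x' i) = inv\<^bsub>S\<^esub> (f (l i)) \<otimes>\<^bsub>S\<^esub> f (x' i)" if "i \<in> V" for i
  proof -
    have U: "l i \<in> Units R" and c: "x i \<in> carrier R" "x' i \<in> carrier R"
      using l p that unfolding p_eq by (auto simp: carrier_generic_torus tree_variety_def)
    then show "f (l i \<otimes>\<^bsub>R\<^esub> x i) = f (l i) \<otimes>\<^bsub>S\<^esub> f (x i)"
      "f (inv\<^bsub>R\<^esub> (l i) \<otimes>\<^bsub>R\<^esub> x' i) = inv\<^bsub>S\<^esub> (f (l i)) \<otimes>\<^bsub>S\<^esub> f (x' i)"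
      using ring_hom_mult[OF f] ring_hom_Units(2)[OF R S f U] R.Units_closed[OF U] R.Units_inv_closed[OF U]
      by simp_all
  qed
  then show ?thesis
    using fp unfolding p_eq torus_action_apply[OF p[unfolded p_eq]]
    by (auto simp: tree_variety_map_def torus_action_apply map_family_def intro!: restrict_ext)
qed

end

theorem corollary3p12:
  fixes k :: "'k ring"
    and V :: "'v set" and E :: "'v set set"
    and \<phi> :: "'v set \<Rightarrow> status"
    and M :: "'v set set"
    and \<alpha> :: "'v \<Rightarrow> 'k"
  defines "\<Lambda> \<equiv> (generic_torus V E \<phi> :: ('k, 'r) module \<Rightarrow> ('v \<Rightarrow> 'r) monoid)"
    and "Y \<equiv> (tree_variety k V E \<phi> M \<alpha> ::
                ('k, 'r) module \<Rightarrow> (('v \<Rightarrow> 'r) \<times> ('v \<Rightarrow> 'r) \<times> ('v \<Rightarrow> 'r)) set)"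
    and "act \<equiv> (torus_action k V E \<phi> M \<alpha> :: ('k, 'r) module \<Rightarrow> _)"
  assumes "field k"
    and "is_tree V E"
    and "maximum_matching E M"
    and "\<forall>u \<in> status_vertices V E \<phi> Generic - \<Union>M. \<alpha> u \<in> Units k"
    and "\<forall>C \<in> rg_components V E. \<phi> C = Generic \<longrightarrow> generic_parameters k V E M \<alpha> C"
  shows "(\<exists>d. int d = rank V E \<phi> \<and> is_torus k \<Lambda> (map_family V) d) \<and>
         is_scheme_action k \<Lambda> (map_family V) Y (tree_variety_map V E \<phi> M) act \<and>
         is_free_action k \<Lambda> Y act"
proof -
  interpret matched_tree V E M
    using assms(5,6) by unfold_locales
  let ?U = "status_vertices V E \<phi> Generic - \<Union>M"
  have k: "cring k"
    using assms(4) by (simp add: field_def domain_def)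
  have \<alpha>: "\<alpha> i \<in> carrier k" if "i \<in> ?U" for i
    using assms(7) that by (auto simp: Units_def)
  have "int (card ?U) = rank V E \<phi>"
    by (simp add: rank_eq_card_uncovered)
  moreover have "is_torus k \<Lambda> (map_family V) (card ?U)"
    unfolding \<Lambda>_def by (rule generic_torus_is_torus)
  moreover have "is_scheme_action k \<Lambda> (map_family V) Y (tree_variety_map V E \<phi> M) act"
    unfolding is_scheme_action_def
  proof (intro conjI allI impI ballI)
    show "group_action (\<Lambda> R) (Y R) (act R)" if "algebra k R" for R
      unfolding \<Lambda>_def Y_def act_def
      using algebra.M_cring[OF that] by (rule torus_action_group_action)
    fix R S :: "('k, 'r) module" and f l p
    assume R: "algebra k R" and S: "algebra k S" and f: "f \<in> alg_hom k R S"
      and l: "l \<in> carrier (\<Lambda> R)" and p: "p \<in> Y R"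
    have RS: "cring R" "cring S"
      using R S by (simp_all add: algebra.M_cring)
    have hom: "f \<in> ring_hom R S"
      using f by (simp add: alg_hom_def)
    show "map_family V f l \<in> carrier (\<Lambda> S)"
      using map_generic_torus[OF RS hom] l unfolding \<Lambda>_def by simp
    show fp: "tree_variety_map V E \<phi> M f p \<in> Y S"
      using tree_variety_map_closed[OF R S f k \<alpha>] p unfolding Y_def by simp
    show "tree_variety_map V E \<phi> M f (act R l p) = act S (map_family V f l) (tree_variety_map V E \<phi> M f p)"
      using l p fp unfolding \<Lambda>_def Y_def act_def by (rule torus_action_natural[OF RS hom])
  qed
  moreover have "is_free_action k \<Lambda> Y act"
    unfolding is_free_action_def
  proof (intro allI impI ballI)
    fix R p assume R: "algebra k R" and p: "p \<in> Y R"
    then interpret R: cring R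
      by (simp add: algebra.M_cring)
    interpret action: group_action "\<Lambda> R" "Y R" "act R"
      unfolding \<Lambda>_def Y_def act_def by (rule torus_action_group_action) (rule R.is_cring)
    obtain x x' a where p_eq: "p = (x, x', a)" by (cases p)
    have p': "(x, x', a) \<in> tree_variety k V E \<phi> M \<alpha> R"
      using p unfolding p_eq Y_def .
    have trivial: "l = \<one>\<^bsub>\<Lambda> R\<^esub>" if l: "l \<in> stabilizer (\<Lambda> R) (act R) p" for l
    proof -
      have lt: "l \<in> carrier (generic_torus V E \<phi> R)" and fixed: "act R l p = p"
        using l by (simp_all add: stabilizer_def \<Lambda>_def)
      \<comment> \<open>Comparing first components puts each \<open>x i\<close> into the annihilator
        of \<open>l i\<close> minus 1.\<close>
      have "(\<lambda>i\<in>V. l i \<otimes>\<^bsub>R\<^esub> x i) = x"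
        using fixed unfolding act_def p_eq torus_action_apply[OF p'] by simp
      then have "l i \<otimes>\<^bsub>R\<^esub> x i = x i" if "i \<in> V" for i
        using that by (metis restrict_apply')
      then have "l i = \<one>\<^bsub>R\<^esub>" if "i \<in> V" for i
        using torus_fixing_point_trivial[OF assms(4) R lt p' _ assms(7,8) that] by simp
      moreover have "l \<in> extensional V"
        using lt by (auto simp: carrier_generic_torus PiE_iff)
      ultimately show ?thesis
        unfolding \<Lambda>_def one_generic_torus by (intro extensionalityI[of _ V]) auto
    qed
    show "stabilizer (\<Lambda> R) (act R) p = {\<one>\<^bsub>\<Lambda> R\<^esub>}"
    proof (intro subset_antisym subsetI)
      show "l \<in> {\<one>\<^bsub>\<Lambda> R\<^esub>}" if "l \<in> stabilizer (\<Lambda> R) (act R) p" for l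
        unfolding singleton_iff using that by (rule trivial)
      show "l \<in> stabilizer (\<Lambda> R) (act R) p" if "l \<in> {\<one>\<^bsub>\<Lambda> R\<^esub>}" for l
        using action.stabilizer_one_closed[OF p] that by (simp only: singleton_iff)
    qed
  qed
  ultimately show ?thesis
    by (intro conjI exI[of _ "card ?U"])
qed

end
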